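(* There is a sequence $(\theta_d)_{d\ge 1}$ of positive reals with $\theta_d=\Theta(1/\sqrt d)$ (independent of the function $f$, the measure $\mu$ and the exponent $p$ below) such that the following holds. Let $d\in\mathbb N\setminus\{0\}$ and $u=\sqrt{2/3}$. Let $f:(0,\infty)\to[0,\infty)$ be a nonincreasing function, not zero almost everywhere, with $\int_0^R f(t)t^{d-1}\,dt<\infty$ for all $R>0$, and let $\mu$ be the radial measure on $\mathbb R^d$ given by $\mu(A)=\int_A f(\|y\|_2)\,d\lambda^d(y)$. For $R>0$ set $h_u(R)=\mu(B(0,R))/\mu(B(0,uR))$. Assume that $$\sup_{R>0}h_u(R)\ \ge\ u^{-\left(\frac{6\log 2-\log 55}{3\log 3-3\log 2}\right)d}=\left(\frac{64}{55}\right)^{d/6}\ \ge\ \limsup_{R\to\infty}h_u(R).$$ Then for every $p$ with $1\le p<\frac{6\log 2}{\log 55}$ we have $$55^{-1/6}\,2^{1/p}>1\qquad\text{and}\qquad C_{p,d,\mu}\ \ge\ c_{p,d,\mu}\ \ge\ \frac{1}{4+\theta_d}\left(\frac{2^{1/p}}{55^{1/6}}\right)^{d}.$$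
   Context: $\lambda^d$ is Lebesgue measure on $\mathbb R^d$, $\|\cdot\|_2$ is the euclidean norm, and $B(x,r)$ is the closed euclidean ball of center $x$ and radius $r$. For a locally finite nontrivial Borel measure $\mu$ on $\mathbb R^d$ and locally integrable $g$, the centered Hardy–Littlewood maximal function is $$M_\mu g(x)=\sup_{\{r>0:\mu(B(x,r))>0\}}\frac1{\mu(B(x,r))}\int_{B(x,r)}|g|\,d\mu .$$ For $1\le p<\infty$, $c_{p,d,\mu}$ is the smallest constant $c$ such that $\mu(\{M_\mu g\ge\alpha\})\le (c\|g\|_p/\alpha)^p$ for all $g\in L^p(\mathbb R^d,\mu)$ and all $\alpha>0$ (weak type $(p,p)$); $C_{p,d,\mu}\in[0,\infty]$ is the smallest constant $C$ such that $\|M_\mu g\|_{L^p(\mu)}\le C\|g\|_{L^p(\mu)}$ for all $g\in L^p(\mathbb R^d,\mu)$ (strong type $(p,p)$; $C_{p,d,\mu}=\infty$ if there is no finite constant). The function $f$ may be unbounded and may depend on $d$. The notation $a_d=\Theta(b_d)$ means $a_d=O(b_d)$ and $b_d=O(a_d)$. *)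

theory Defs
  imports "HOL-Analysis.Analysis" "HOL-Library.Landau_Symbols"
begin

text \<open>
  The sequence \<open>\<theta>\<close> below is uniform over all dimensions, so the dimension has to be a
  value and not a type. Hence \<open>\<real>\<^sup>d\<close> is represented by the extensional functions
  \<open>{..<d} \<rightarrow>\<^sub>E UNIV\<close> of type \<open>nat \<Rightarrow> real\<close>, and a Borel measure on it is
  a measure with the same \<open>\<sigma>\<close>-algebra as the \<open>d\<close>-fold product of \<open>lborel\<close>.
\<close>

definition lborel_dim :: "nat \<Rightarrow> (nat \<Rightarrow> real) measure" where
  "lborel_dim d = (\<Pi>\<^sub>M i\<in>{..<d}. lborel)"

definition origin :: "nat \<Rightarrow> nat \<Rightarrow> real" where
  "origin d = (\<lambda>i\<in>{..<d}. 0)"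

definition norm2 :: "nat \<Rightarrow> (nat \<Rightarrow> real) \<Rightarrow> real" where
  "norm2 d y = L2_set y {..<d}"

definition eball :: "nat \<Rightarrow> (nat \<Rightarrow> real) \<Rightarrow> real \<Rightarrow> (nat \<Rightarrow> real) set" where
  "eball d x r = {y \<in> space (lborel_dim d). norm2 d (\<lambda>i. y i - x i) \<le> r}"

text \<open>Real powers \<open>x\<^sup>p\<close> with \<open>p > 0\<close> on \<open>[0,\<infinity>]\<close>.\<close>

definition ennreal_powr :: "ennreal \<Rightarrow> real \<Rightarrow> ennreal" where
  "ennreal_powr x p = (if x = \<infinity> then \<infinity> else ennreal (enn2real x powr p))"

definition Lp_norm :: "(nat \<Rightarrow> real) measure \<Rightarrow> real \<Rightarrow> ((nat \<Rightarrow> real) \<Rightarrow> ennreal) \<Rightarrow> ennreal" where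
  "Lp_norm \<mu> p F = ennreal_powr (\<integral>\<^sup>+x. ennreal_powr (F x) p \<partial>\<mu>) (1 / p)"

definition Lp_space :: "(nat \<Rightarrow> real) measure \<Rightarrow> real \<Rightarrow> ((nat \<Rightarrow> real) \<Rightarrow> real) set" where
  "Lp_space \<mu> p = {g \<in> borel_measurable \<mu>. Lp_norm \<mu> p (\<lambda>x. ennreal \<bar>g x\<bar>) < \<infinity>}"

definition HL_maximal ::
  "nat \<Rightarrow> (nat \<Rightarrow> real) measure \<Rightarrow> ((nat \<Rightarrow> real) \<Rightarrow> real) \<Rightarrow> (nat \<Rightarrow> real) \<Rightarrow> ennreal" where
  "HL_maximal d \<mu> g x =
     (SUP r \<in> {r. r > 0 \<and> emeasure \<mu> (eball d x r) > 0}.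
        (\<integral>\<^sup>+y\<in>eball d x r. ennreal \<bar>g y\<bar> \<partial>\<mu>) / emeasure \<mu> (eball d x r))"

text \<open>
  The best constants live in \<open>[0,\<infinity>]\<close>; the constant \<open>\<infinity>\<close> is always admissible,
  since \<open>\<infinity> * 0 = 0\<close> in \<^typ>\<open>ennreal\<close> and the maximal function of a null function vanishes.
\<close>

definition weak_type_const :: "real \<Rightarrow> nat \<Rightarrow> (nat \<Rightarrow> real) measure \<Rightarrow> ennreal" where
  "weak_type_const p d \<mu> =
     Inf {c. \<forall>g \<in> Lp_space \<mu> p. \<forall>\<alpha>::real. \<alpha> > 0 \<longrightarrow>
            emeasure \<mu> {x \<in> space \<mu>. HL_maximal d \<mu> g x \<ge> ennreal \<alpha>}
              \<le> ennreal_powr (c * Lp_norm \<mu> p (\<lambda>x. ennreal \<bar>g x\<bar>) / ennreal \<alpha>) p}"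

definition strong_type_const :: "real \<Rightarrow> nat \<Rightarrow> (nat \<Rightarrow> real) measure \<Rightarrow> ennreal" where
  "strong_type_const p d \<mu> =
     Inf {C. \<forall>g \<in> Lp_space \<mu> p.
            Lp_norm \<mu> p (HL_maximal d \<mu> g) \<le> C * Lp_norm \<mu> p (\<lambda>x. ennreal \<bar>g x\<bar>)}"

text \<open>
  Functions on \<open>(0,\<infinity>)\<close> are modelled by total functions on the reals. Negative arguments are
  never used, and the value at \<open>0\<close> only matters on the null set consisting of the origin.
\<close>

definition radial_measure :: "nat \<Rightarrow> (real \<Rightarrow> real) \<Rightarrow> (nat \<Rightarrow> real) measure" where
  "radial_measure d f = density (lborel_dim d) (\<lambda>y. ennreal (f (norm2 d y)))"

definition ball_ratio :: "nat \<Rightarrow> (nat \<Rightarrow> real) measure \<Rightarrow> real \<Rightarrow> real \<Rightarrow> ennreal" where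
  "ball_ratio d \<mu> u R =
     emeasure \<mu> (eball d (origin d) R) / emeasure \<mu> (eball d (origin d) (u * R))"

end

theory Submission
  imports Defs
begin

text \<open>
  Write \<open>m(R) = \<mu>(B(0,R))\<close>, \<open>V = (64/55)\<^sup>d\<^sup>/\<^sup>6\<close> and \<open>b = 55\<^sup>-\<^sup>1\<^sup>/\<^sup>6\<close>, so that
  \<open>V = (2b)\<^sup>d\<close>. The weak type inequality is tested on the indicator function of a ball
  \<open>B(0,\<rho>)\<close> with \<open>\<rho> = b u R\<close>, at a level that its maximal function reaches on all of
  \<open>B(0,R)\<close>.

  The radius \<open>R\<close> is one at which the measure grows by about \<open>V\<close> between \<open>uR\<close> and \<open>R\<close>, and by
  not much more than \<open>V\<close> across each later interval \<open>[uS, S]\<close>; the two hypotheses on the growth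
  ratio provide it (\<open>radius_with_critical_growth\<close>). For \<open>|x| \<le> R\<close> the averaging ball is
  \<open>B(x,r)\<close> with \<open>r\<^sup>2 = |x|\<^sup>2 + \<rho>\<^sup>2\<close>. By Pythagoras it contains the half of \<open>B(0,\<rho>)\<close> that faces
  \<open>x\<close>. Outside \<open>B(0,uR)\<close>, on the other hand, it only meets small caps: a point of it at
  distance \<open>t\<close> from the origin makes an angle with \<open>x\<close> whose cosine is bounded below, and such
  a cone carries an exponentially small fraction of every radial measure. This fraction beats the
  at most exponential growth of \<open>m\<close>, so \<open>\<mu>(B(x,r)) \<le> (1 + 38 q\<^sup>d) m(uR)\<close> with
  \<open>q = 99/100\<close> (\<open>averaging_ball_mass_le\<close>, \<open>cap_sum_le\<close>). Hence the maximal function is at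
  least about \<open>\<alpha> = m(\<rho>) / (2 m(uR))\<close> on \<open>B(0,R)\<close>, and the best constant is at least
  \<open>\<alpha> (m(R)/m(\<rho>))\<^sup>1\<^sup>/\<^sup>p\<close>. Because the density is nonincreasing, \<open>m(\<rho>) \<ge> b\<^sup>d m(uR)\<close>, and
  together with \<open>m(R) \<ge> (V/2) m(uR)\<close> this is the claim. One factor \<open>2\<close> comes from the half
  ball, the other one from the choice of \<open>R\<close>; the exponentially small error is absorbed in
  \<open>\<theta>\<^sub>d = 15200/\<surd>d\<close>.

  Rotations are avoided throughout. Translations and dilations of Lebesgue measure suffice,
  because a cap of the unit ball fits into a smaller ball (\<open>cap_cone_unit_ball_le\<close>), and because
  the image of Lebesgue measure on a cone under the norm is determined by scaling alone
  (\<open>distr_norm2_cone\<close>). This last fact transfers the cap estimate from Lebesgue measure to all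
  radial measures.
\<close>

section \<open>Lebesgue measure on euclidean space of variable dimension\<close>

interpretation lborel_coords: product_sigma_finite "\<lambda>_::nat. lborel :: real measure"
  by standard

interpretation lborel_dim: sigma_finite_measure "lborel_dim d"
  unfolding lborel_dim_def by (rule lborel_coords.sigma_finite) simp

definition affine_map :: "nat \<Rightarrow> (nat \<Rightarrow> real) \<Rightarrow> real \<Rightarrow> (nat \<Rightarrow> real) \<Rightarrow> nat \<Rightarrow> real" where
  "affine_map d z c y = (\<lambda>i\<in>{..<d}. z i + c * y i)"

definition dot :: "nat \<Rightarrow> (nat \<Rightarrow> real) \<Rightarrow> (nat \<Rightarrow> real) \<Rightarrow> real" where
  "dot d x y = (\<Sum>i<d. x i * y i)"

lemma space_lborel_dim: "space (lborel_dim d) = ({..<d} \<rightarrow>\<^sub>E UNIV)"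
  by (simp add: lborel_dim_def space_PiM)

lemma measurable_coord:
  "i < d \<Longrightarrow> (\<lambda>y. y i) \<in> borel_measurable (lborel_dim d)"
  unfolding lborel_dim_def by measurable

lemma measurable_affine_map [measurable]:
  "affine_map d z c \<in> measurable (lborel_dim d) (lborel_dim d)"
  unfolding affine_map_def lborel_dim_def by measurable

lemma affine_map_in_space [simp]: "affine_map d z c y \<in> space (lborel_dim d)"
  by (simp add: affine_map_def space_lborel_dim)

lemma norm2_nonneg [simp]: "0 \<le> norm2 d y"
  by (simp add: norm2_def)

lemma norm2_cong: "(\<And>i. i < d \<Longrightarrow> x i = y i) \<Longrightarrow> norm2 d x = norm2 d y"
  unfolding norm2_def by (rule L2_set_cong) auto

lemma norm2_scale: "norm2 d (\<lambda>i. c * y i) = \<bar>c\<bar> * norm2 d y"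
  unfolding norm2_def L2_set_def
  by (simp add: power_mult_distrib sum_distrib_left[symmetric] real_sqrt_mult)

lemma norm2_square: "(norm2 d y)\<^sup>2 = (\<Sum>i<d. (y i)\<^sup>2)"
  by (simp add: norm2_def L2_set_def sum_nonneg)

lemma norm2_diff_square:
  "(norm2 d (\<lambda>i. y i - x i))\<^sup>2 = (norm2 d y)\<^sup>2 - 2 * dot d x y + (norm2 d x)\<^sup>2"
  unfolding norm2_square dot_def sum_distrib_left sum.distrib[symmetric] sum_subtractf[symmetric]
  by (intro sum.cong) (auto simp: power2_eq_square algebra_simps)

lemma measurable_norm2_compose:
  assumes "\<And>i. i < d \<Longrightarrow> (\<lambda>w. y w i) \<in> borel_measurable M"
  shows "(\<lambda>w. norm2 d (y w)) \<in> borel_measurable M"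
  unfolding norm2_def L2_set_def
  by (intro borel_measurable_sqrt[THEN measurable_compose_rev] borel_measurable_sum borel_measurable_power) (use assms in auto)

lemma measurable_norm2 [measurable]: "norm2 d \<in> borel_measurable (lborel_dim d)"
  using measurable_norm2_compose[of d "\<lambda>y. y"] measurable_coord by simp

lemma measurable_dot [measurable]: "dot d x \<in> borel_measurable (lborel_dim d)"
  unfolding dot_def by (intro borel_measurable_sum borel_measurable_times) (auto intro: measurable_coord)

lemma sets_eball [measurable]: "eball d x r \<in> sets (lborel_dim d)"
proof -
  have "(\<lambda>y. norm2 d (\<lambda>i. y i - x i)) \<in> borel_measurable (lborel_dim d)"
    by (intro measurable_norm2_compose borel_measurable_diff measurable_coord) auto
  then show ?thesis unfolding eball_def by measurable
qed

lemma eball_origin: "eball d (origin d) r = {y \<in> space (lborel_dim d). norm2 d y \<le> r}"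
  unfolding eball_def by (intro Collect_cong conj_cong refl arg_cong2[where f="(\<le>)"] norm2_cong)
    (auto simp: origin_def)

lemma emeasure_lborel_affine:
  fixes c :: real
  assumes [measurable]: "A \<in> sets borel" and c: "c \<noteq> 0"
  shows "emeasure lborel A = ennreal \<bar>c\<bar> * emeasure lborel ((\<lambda>x. t + c * x) -` A)"
proof -
  have "emeasure lborel A
      = emeasure (density (distr lborel borel (\<lambda>x. t + c * x)) (\<lambda>_. ennreal \<bar>c\<bar>)) A"
    by (subst lborel_real_affine[OF c, of t]) (rule refl)
  then show ?thesis
    by (simp add: emeasure_density nn_integral_cmult_indicator emeasure_distr)
qed

text \<open>Both sides agree on boxes, where the identity is the product of the one-dimensional
  change of variables.\<close>

lemma lborel_dim_affine:
  assumes c: "c \<noteq> 0"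
  shows "density (distr (lborel_dim d) (lborel_dim d) (affine_map d z c)) (\<lambda>_. ennreal (\<bar>c\<bar> ^ d))
    = lborel_dim d" (is "?P = _")
proof -
  have "?P = (\<Pi>\<^sub>M i\<in>{..<d}. lborel)"
  proof (rule lborel_coords.PiM_eqI)
    show "sets ?P = sets (\<Pi>\<^sub>M i\<in>{..<d}. lborel)" by (simp add: lborel_dim_def)
  next
    fix A :: "nat \<Rightarrow> real set" assume A: "\<And>i. i \<in> {..<d} \<Longrightarrow> A i \<in> sets lborel"
    let ?B = "\<lambda>i. (\<lambda>x. z i + c * x) -` A i"
    have box: "Pi\<^sub>E {..<d} A \<in> sets (lborel_dim d)"
      unfolding lborel_dim_def using A by (intro sets_PiM_I_finite) auto
    have B: "?B i \<in> sets lborel" if "i \<in> {..<d}" for i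
    proof -
      have "(\<lambda>x. z i + c * x) \<in> measurable borel borel" by measurable
      from measurable_sets[OF this, of "A i"] A[OF that] show ?thesis by simp
    qed
    have pre: "affine_map d z c -` Pi\<^sub>E {..<d} A \<inter> space (lborel_dim d) = Pi\<^sub>E {..<d} ?B"
      by (auto simp: affine_map_def space_lborel_dim PiE_iff)
    have "emeasure ?P (Pi\<^sub>E {..<d} A) = ennreal (\<bar>c\<bar> ^ d) * emeasure (lborel_dim d) (Pi\<^sub>E {..<d} ?B)"
      using box by (simp add: emeasure_density nn_integral_cmult_indicator emeasure_distr pre)
    also have "\<dots> = (\<Prod>i<d. ennreal \<bar>c\<bar> * emeasure lborel (?B i))"
      unfolding lborel_dim_def using B
      by (subst lborel_coords.emeasure_PiM) (auto simp: prod.distrib ennreal_power)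
    also have "\<dots> = (\<Prod>i<d. emeasure lborel (A i))"
      using A by (intro prod.cong refl emeasure_lborel_affine[symmetric] c) auto
    finally show "emeasure ?P (Pi\<^sub>E {..<d} A) = (\<Prod>i<d. emeasure lborel (A i))" .
  qed simp
  then show ?thesis by (simp add: lborel_dim_def)
qed

lemma emeasure_lborel_dim_affine:
  assumes c: "c \<noteq> 0" and A: "A \<in> sets (lborel_dim d)"
  shows "emeasure (lborel_dim d) A
    = ennreal (\<bar>c\<bar> ^ d) * emeasure (lborel_dim d) (affine_map d z c -` A \<inter> space (lborel_dim d))"
  using A by (subst lborel_dim_affine[OF c, of d z, symmetric])
    (simp add: emeasure_density nn_integral_cmult_indicator emeasure_distr)

lemma norm2_affine_diff: "norm2 d (\<lambda>i. affine_map d z c y i - z i) = \<bar>c\<bar> * norm2 d y"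
  unfolding norm2_scale[symmetric] by (rule norm2_cong) (simp add: affine_map_def)

abbreviation unit_ball_vol :: "nat \<Rightarrow> ennreal" where
  "unit_ball_vol d \<equiv> emeasure (lborel_dim d) (eball d (origin d) 1)"

lemma emeasure_eball:
  assumes "r > 0"
  shows "emeasure (lborel_dim d) (eball d x r) = ennreal (r ^ d) * unit_ball_vol d"
proof -
  have "affine_map d x r -` eball d x r \<inter> space (lborel_dim d) = eball d (origin d) 1"
    unfolding eball_origin unfolding eball_def using assms by (auto simp: norm2_affine_diff)
  then show ?thesis
    using emeasure_lborel_dim_affine[of r "eball d x r" d x] assms by simp
qed

text \<open>The unit ball lies between the cubes of half side \<open>1/d\<close> and \<open>1\<close>; the inner one is
  used in the next lemma.\<close>

lemma unit_ball_vol_finite: "unit_ball_vol d < \<infinity>"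
proof -
  have "\<bar>y i\<bar> \<le> norm2 d y" if "i < d" for i and y :: "nat \<Rightarrow> real"
  proof -
    have "(y i)\<^sup>2 \<le> (norm2 d y)\<^sup>2"
      unfolding norm2_square using that by (intro member_le_sum) auto
    then show ?thesis by (simp add: abs_le_square_iff[symmetric])
  qed
  then have "\<bar>y i\<bar> \<le> 1" if "norm2 d y \<le> 1" "i < d" for i and y :: "nat \<Rightarrow> real"
    using that order_trans by blast
  then have "eball d (origin d) 1 \<subseteq> Pi\<^sub>E {..<d} (\<lambda>_. {-1..1})"
    unfolding eball_origin by (auto simp: space_lborel_dim PiE_iff abs_le_iff minus_le_iff extensional_def)
  then have "unit_ball_vol d \<le> emeasure (lborel_dim d) (Pi\<^sub>E {..<d} (\<lambda>_. {-1..1}))"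
    by (intro emeasure_mono) (auto simp: lborel_dim_def intro!: sets_PiM_I_finite)
  also have "\<dots> < \<infinity>"
    unfolding lborel_dim_def by (subst lborel_coords.emeasure_PiM) (auto simp: power_less_top_ennreal)
  finally show ?thesis .
qed

lemma unit_ball_vol_pos:
  assumes "d \<ge> 1" shows "0 < unit_ball_vol d"
proof -
  have "norm2 d y \<le> 1" if "\<And>i. i < d \<Longrightarrow> \<bar>y i\<bar> \<le> 1 / real d" for y
  proof -
    have "norm2 d y \<le> (\<Sum>i<d. \<bar>y i\<bar>)" unfolding norm2_def by (rule L2_set_le_sum_abs)
    also have "\<dots> \<le> (\<Sum>i<d. 1 / real d)" using that by (intro sum_mono) auto
    also have "\<dots> = 1" using assms by simp
    finally show ?thesis .
  qed
  then have sub: "Pi\<^sub>E {..<d} (\<lambda>_. {- (1 / real d)..1 / real d}) \<subseteq> eball d (origin d) 1"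
    unfolding eball_origin by (fastforce simp: space_lborel_dim PiE_iff abs_le_iff)
  have "0 < (\<Prod>i<d. ennreal (2 / real d))"
    using assms by (simp add: zero_less_iff_neq_zero ennreal_power)
  also have "\<dots> = emeasure (lborel_dim d) (Pi\<^sub>E {..<d} (\<lambda>_. {- (1 / real d)..1 / real d}))"
    unfolding lborel_dim_def by (subst lborel_coords.emeasure_PiM) auto
  also have "\<dots> \<le> unit_ball_vol d" using sub by (intro emeasure_mono) auto
  finally show ?thesis .
qed

section \<open>Cones and polar coordinates\<close>

definition measurable_cone :: "nat \<Rightarrow> (nat \<Rightarrow> real) set \<Rightarrow> bool" where
  "measurable_cone d C \<longleftrightarrow> C \<in> sets (lborel_dim d) \<and>
    (\<forall>r>0. \<forall>y\<in>space (lborel_dim d). affine_map d (\<lambda>_. 0) r y \<in> C \<longleftrightarrow> y \<in> C)"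

lemma emeasure_cone_eball:
  assumes "measurable_cone d C" "r > 0"
  shows "emeasure (lborel_dim d) (C \<inter> eball d (origin d) r)
    = ennreal (r ^ d) * emeasure (lborel_dim d) (C \<inter> eball d (origin d) 1)"
proof -
  have n: "norm2 d (affine_map d (\<lambda>_. 0) r y) = r * norm2 d y" for y
    using norm2_affine_diff[of d "\<lambda>_. 0" r y] assms(2) by simp
  have "affine_map d (\<lambda>_. 0) r -` (C \<inter> eball d (origin d) r) \<inter> space (lborel_dim d)
      = C \<inter> eball d (origin d) 1"
    unfolding eball_origin using assms by (auto simp: measurable_cone_def n dest: sets.sets_into_space)
  then show ?thesis
    using emeasure_lborel_dim_affine[of r "C \<inter> eball d (origin d) r" d "\<lambda>_. 0"] assms
    by (simp add: measurable_cone_def sets.Int)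
qed

lemma nn_integral_power_Iic:
  assumes d: "d \<ge> 1" and a: "a \<ge> 0"
  shows "(\<integral>\<^sup>+t\<in>{0<..a}. ennreal (real d * t ^ (d - 1)) \<partial>lborel) = ennreal (a ^ d)"
proof -
  have "(\<integral>\<^sup>+t\<in>{0<..a}. ennreal (real d * t ^ (d - 1)) \<partial>lborel)
      = (\<integral>\<^sup>+t\<in>{0..a}. ennreal (real d * t ^ (d - 1)) \<partial>lborel)"
    by (intro nn_integral_cong_AE eventually_mono[OF AE_lborel_singleton[of "0::real"]])
      (auto simp: indicator_def)
  also have "\<dots> = ennreal (a ^ d - 0 ^ d)"
    using a by (intro nn_integral_FTC_Icc) (auto intro!: derivative_eq_intros)
  finally show ?thesis using d by (simp add: zero_power)
qed

lemma emeasure_cone_origin: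
  assumes d: "d \<ge> 1" and C: "C \<in> sets (lborel_dim d)"
  shows "emeasure (lborel_dim d) (C \<inter> eball d (origin d) 0) = 0"
proof -
  have "eball d (origin d) 0 \<subseteq> Pi\<^sub>E {..<d} (\<lambda>_. {0})"
  proof
    fix y assume y: "y \<in> eball d (origin d) 0"
    then have "norm2 d y = 0" using norm2_nonneg[of d y] by (simp add: eball_origin)
    then show "y \<in> Pi\<^sub>E {..<d} (\<lambda>_. {0})"
      using y unfolding eball_origin norm2_def space_lborel_dim
      by (auto simp: L2_set_eq_0_iff PiE_iff extensional_def fun_eq_iff)
  qed
  then have "emeasure (lborel_dim d) (C \<inter> eball d (origin d) 0) \<le> emeasure (lborel_dim d) (Pi\<^sub>E {..<d} (\<lambda>_. {0}))"
    unfolding lborel_dim_def by (intro emeasure_mono sets_PiM_I_finite le_infI2) auto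
  also have "\<dots> = 0"
    using d unfolding lborel_dim_def by (subst lborel_coords.emeasure_PiM) (auto simp: zero_power)
  finally show ?thesis by simp
qed

text \<open>Polar coordinates on a cone \<open>C\<close>. By scaling, the part of \<open>C\<close> in the ball of radius \<open>a\<close>
  has Lebesgue measure proportional to \<open>a\<^sup>d\<close>, which is the integral of \<open>d t\<^sup>d\<^sup>-\<^sup>1\<close> over
  \<open>(0,a]\<close>; the half-lines \<open>(-\<infinity>,a]\<close> determine the measure. The angular part of \<open>C\<close>
  enters only through a constant factor.\<close>

lemma distr_norm2_cone:
  assumes d: "d \<ge> 1" and C: "measurable_cone d C"
  shows "distr (density (lborel_dim d) (indicator C)) borel (norm2 d)
    = density lborel (\<lambda>t. emeasure (lborel_dim d) (C \<inter> eball d (origin d) 1)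
        * (ennreal (real d * t ^ (d - 1)) * indicator {0<..} t))" (is "?M = ?N")
proof (rule measure_eqI_generator_eq[where E = "range (\<lambda>a. {..a})" and \<Omega> = UNIV and A = "\<lambda>n. {..real n}"])
  have Cs [measurable]: "C \<in> sets (lborel_dim d)" using C by (simp add: measurable_cone_def)
  let ?k = "emeasure (lborel_dim d) (C \<inter> eball d (origin d) 1)"
  have kfin: "?k < \<infinity>"
    using unit_ball_vol_finite[of d] by (rule le_less_trans[rotated]) (intro emeasure_mono; simp)
  have M: "emeasure ?M {..a} = emeasure (lborel_dim d) (C \<inter> eball d (origin d) a)" for a
  proof -
    have "emeasure ?M {..a}
        = (\<integral>\<^sup>+y. indicator C y * indicator (norm2 d -` {..a} \<inter> space (lborel_dim d)) y \<partial>lborel_dim d)"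
      by (simp add: emeasure_distr emeasure_density)
    also have "\<dots> = (\<integral>\<^sup>+y. indicator (C \<inter> eball d (origin d) a) y \<partial>lborel_dim d)"
      by (intro nn_integral_cong) (auto simp: eball_origin indicator_def)
    finally show ?thesis by simp
  qed
  have N: "emeasure ?N {..a} = ?k * ennreal (if a \<ge> 0 then a ^ d else 0)" for a
  proof -
    have "emeasure ?N {..a} = (\<integral>\<^sup>+t. ?k * (ennreal (real d * t ^ (d - 1)) * indicator {0<..a} t) \<partial>lborel)"
      by (simp add: emeasure_density) (intro nn_integral_cong, auto simp: indicator_def)
    also have "\<dots> = ?k * (\<integral>\<^sup>+t\<in>{0<..a}. ennreal (real d * t ^ (d - 1)) \<partial>lborel)"
      by (intro nn_integral_cmult) measurable
    also have "\<dots> = ?k * ennreal (if a \<ge> 0 then a ^ d else 0)"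
      using nn_integral_power_Iic[OF d, of a] by (cases "a \<ge> 0") auto
    finally show ?thesis .
  qed
  have MN: "emeasure ?M {..a} = emeasure ?N {..a}" for a
  proof -
    consider "a < 0" | "a = 0" | "a > 0" by linarith
    then show ?thesis
    proof cases
      case 1
      then have "eball d (origin d) a = {}"
        unfolding eball_origin by (auto simp: not_le intro: less_le_trans[OF _ norm2_nonneg])
      then show ?thesis using 1 unfolding M N by simp
    next
      case 2 then show ?thesis
        using d emeasure_cone_origin[OF d Cs] unfolding M N by (simp add: zero_power)
    next
      case 3 then show ?thesis
        unfolding M N emeasure_cone_eball[OF C 3] by (simp add: mult.commute)
    qed
  qed
  show "Int_stable (range (\<lambda>a::real. {..a}))"
    by (auto simp: Int_stable_def)
  show "emeasure ?M X = emeasure ?N X" if "X \<in> range (\<lambda>a. {..a})" for X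
    using that MN by auto
  show "sets ?M = sigma_sets UNIV (range (\<lambda>a::real. {..a}))"
    "sets ?N = sigma_sets UNIV (range (\<lambda>a::real. {..a}))"
    by (simp_all add: borel_eq_atMost)
  show "(\<Union>n. {..real n}) = UNIV" by (auto intro: real_arch_simple)
  show "emeasure ?M {..real n} \<noteq> \<infinity>" for n
    unfolding MN N using kfin by (simp add: ennreal_mult_eq_top_iff less_top)
qed auto

lemma nn_integral_radial_cone:
  assumes d: "d \<ge> 1" and C: "measurable_cone d C" and F [measurable]: "F \<in> borel_measurable borel"
  shows "(\<integral>\<^sup>+y\<in>C. F (norm2 d y) \<partial>lborel_dim d)
    = emeasure (lborel_dim d) (C \<inter> eball d (origin d) 1)
      * (\<integral>\<^sup>+t\<in>{0<..}. F t * ennreal (real d * t ^ (d - 1)) \<partial>lborel)"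
proof -
  have [measurable]: "C \<in> sets (lborel_dim d)" using C by (simp add: measurable_cone_def)
  let ?k = "emeasure (lborel_dim d) (C \<inter> eball d (origin d) 1)"
  have "(\<integral>\<^sup>+y\<in>C. F (norm2 d y) \<partial>lborel_dim d)
      = (\<integral>\<^sup>+t. F t \<partial>distr (density (lborel_dim d) (indicator C)) borel (norm2 d))"
    by (subst nn_integral_distr) (auto simp: nn_integral_density mult.commute)
  also have "\<dots> = (\<integral>\<^sup>+t. ?k * (F t * ennreal (real d * t ^ (d - 1)) * indicator {0<..} t) \<partial>lborel)"
    unfolding distr_norm2_cone[OF d C] by (subst nn_integral_density) (auto simp: mult_ac)
  also have "\<dots> = ?k * (\<integral>\<^sup>+t\<in>{0<..}. F t * ennreal (real d * t ^ (d - 1)) \<partial>lborel)"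
    by (intro nn_integral_cmult) measurable
  finally show ?thesis .
qed

lemma measurable_cone_space: "measurable_cone d (space (lborel_dim d))"
  by (auto simp: measurable_cone_def)

lemma affine_map_0_norm_dot:
  "norm2 d (affine_map d (\<lambda>_. 0) r y) = \<bar>r\<bar> * norm2 d y"
  "dot d x (affine_map d (\<lambda>_. 0) r y) = r * dot d x y"
  using norm2_affine_diff[of d "\<lambda>_. 0" r y] by (simp, auto simp: dot_def affine_map_def sum_distrib_left mult_ac)

definition cap_cone :: "nat \<Rightarrow> (nat \<Rightarrow> real) \<Rightarrow> real \<Rightarrow> (nat \<Rightarrow> real) set" where
  "cap_cone d e c = {y \<in> space (lborel_dim d). dot d e y \<ge> c * norm2 d y}"

lemma measurable_cone_cap_cone: "measurable_cone d (cap_cone d e c)"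
proof -
  have "cap_cone d e c \<in> sets (lborel_dim d)" unfolding cap_cone_def by measurable
  moreover have "r * dot d e y \<ge> c * (r * norm2 d y) \<longleftrightarrow> dot d e y \<ge> c * norm2 d y" if "r > 0" for r y
    using that by (metis mult.left_commute mult_le_cancel_left_pos)
  ultimately show ?thesis
    by (auto simp: measurable_cone_def cap_cone_def affine_map_0_norm_dot)
qed

text \<open>The part of the cone in the unit ball lies in the ball with center \<open>c e\<close> and radius
  \<open>\<surd>(1 - c\<^sup>2)\<close>: for \<open>n = |y|\<close> the squared distance from \<open>y\<close> to \<open>c e\<close> is at most
  \<open>n\<^sup>2 - 2 c\<^sup>2 n + c\<^sup>2\<close>, a convex function of \<open>n\<close> that is at most \<open>1 - c\<^sup>2\<close> at \<open>n = 0\<close> (this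
  is where \<open>c\<^sup>2 \<le> 1/2\<close> enters) and at \<open>n = 1\<close>. It is convenient to let \<open>e\<close> be shorter than a
  unit vector, since \<open>e\<close> will be \<open>x/R\<close> with \<open>|x| \<le> R\<close>.\<close>

lemma cap_cone_unit_ball_le:
  assumes e: "norm2 d e \<le> 1" and c: "0 \<le> c" "c\<^sup>2 \<le> 1 / 2"
  shows "emeasure (lborel_dim d) (cap_cone d e c \<inter> eball d (origin d) 1)
    \<le> ennreal (sqrt (1 - c\<^sup>2) ^ d) * unit_ball_vol d"
proof -
  have "cap_cone d e c \<inter> eball d (origin d) 1 \<subseteq> eball d (\<lambda>i. c * e i) (sqrt (1 - c\<^sup>2))"
  proof
    fix y assume y: "y \<in> cap_cone d e c \<inter> eball d (origin d) 1"
    then have y1: "norm2 d y \<le> 1" and yc: "dot d e y \<ge> c * norm2 d y"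
      by (auto simp: cap_cone_def eball_origin)
    have dot: "dot d (\<lambda>i. c * e i) y = c * dot d e y"
      by (simp add: dot_def sum_distrib_left mult_ac)
    have "(norm2 d (\<lambda>i. y i - c * e i))\<^sup>2 = (norm2 d y)\<^sup>2 - 2 * (c * dot d e y) + c\<^sup>2 * (norm2 d e)\<^sup>2"
      unfolding norm2_diff_square dot norm2_scale by (simp add: power_mult_distrib)
    also have "\<dots> \<le> (norm2 d y)\<^sup>2 - 2 * (c * (c * norm2 d y)) + c\<^sup>2 * 1"
      using e yc c by (intro add_mono diff_mono mult_left_mono) (auto simp: power_le_one)
    also have "\<dots> = 1 - c\<^sup>2 - (1 - norm2 d y) * (1 + norm2 d y - 2 * c\<^sup>2)"
      by (simp add: power2_eq_square algebra_simps)
    also have "\<dots> \<le> 1 - c\<^sup>2"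
    proof -
      have "0 \<le> (1 - norm2 d y) * (1 + norm2 d y - 2 * c\<^sup>2)"
        using y1 c norm2_nonneg[of d y] by (intro mult_nonneg_nonneg) linarith+
      then show ?thesis by linarith
    qed
    finally have "norm2 d (\<lambda>i. y i - c * e i) \<le> sqrt (1 - c\<^sup>2)" by (rule real_le_rsqrt)
    then show "y \<in> eball d (\<lambda>i. c * e i) (sqrt (1 - c\<^sup>2))"
      using y by (auto simp: eball_def cap_cone_def)
  qed
  then have "emeasure (lborel_dim d) (cap_cone d e c \<inter> eball d (origin d) 1)
      \<le> emeasure (lborel_dim d) (eball d (\<lambda>i. c * e i) (sqrt (1 - c\<^sup>2)))"
    by (intro emeasure_mono) auto
  also have "\<dots> = ennreal (sqrt (1 - c\<^sup>2) ^ d) * unit_ball_vol d"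
    using c by (intro emeasure_eball) auto
  finally show ?thesis .
qed

text \<open>The half ball and its reflection in the origin cover the ball.\<close>

lemma half_space_unit_ball_ge:
  "unit_ball_vol d \<le> 2 * emeasure (lborel_dim d) (cap_cone d e 0 \<inter> eball d (origin d) 1)"
proof -
  let ?H = "cap_cone d e 0 \<inter> eball d (origin d) 1"
  let ?H' = "affine_map d (\<lambda>_. 0) (-1) -` ?H \<inter> space (lborel_dim d)"
  have H: "?H \<in> sets (lborel_dim d)" using measurable_cone_cap_cone[of d e 0] by (auto simp: measurable_cone_def)
  then have H': "?H' \<in> sets (lborel_dim d)" by (intro measurable_sets[OF measurable_affine_map])
  have "eball d (origin d) 1 \<subseteq> ?H \<union> ?H'"
    by (auto simp: eball_origin cap_cone_def affine_map_0_norm_dot)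
  then have "unit_ball_vol d \<le> emeasure (lborel_dim d) (?H \<union> ?H')"
    using H H' by (intro emeasure_mono) auto
  also have "\<dots> \<le> emeasure (lborel_dim d) ?H + emeasure (lborel_dim d) ?H'"
    by (rule emeasure_subadditive[OF H H'])
  also have "emeasure (lborel_dim d) ?H' = emeasure (lborel_dim d) ?H"
    using emeasure_lborel_dim_affine[OF _ H, of "-1" "\<lambda>_. 0"] by simp
  finally show ?thesis by (simp add: mult_2)
qed

section \<open>Radial measures with a nonincreasing density\<close>

locale radial_decreasing =
  fixes d :: nat and f :: "real \<Rightarrow> real"
  assumes d: "d \<ge> 1"
    and f_nonneg: "\<And>t. t > 0 \<Longrightarrow> f t \<ge> 0"
    and f_antimono: "antimono_on {0<..} f"
    and f_nonzero: "\<not> (AE t in lborel. t > 0 \<longrightarrow> f t = 0)"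
    and f_locally_integrable:
      "\<And>R. R > 0 \<Longrightarrow> (\<integral>\<^sup>+t\<in>{0<..<R}. ennreal (f t * t ^ (d - 1)) \<partial>lborel) < \<infinity>"
begin

abbreviation \<mu> :: "(nat \<Rightarrow> real) measure" where
  "\<mu> \<equiv> radial_measure d f"

abbreviation cball0 :: "real \<Rightarrow> (nat \<Rightarrow> real) set" where
  "cball0 R \<equiv> eball d (origin d) R"

text \<open>The values of \<open>f\<close> at negative arguments are arbitrary, so \<open>f\<close> need not be Borel
  measurable on the whole line; this truncation is.\<close>

definition profile :: "real \<Rightarrow> ennreal" where
  "profile t = (if t < 0 then 0 else ennreal (f t))"

lemma measurable_profile [measurable]: "profile \<in> borel_measurable borel"
proof -
  have "mono_on {0<..} (\<lambda>t. - f t)"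
    using f_antimono by (auto simp: monotone_on_def)
  then have "(\<lambda>t. - f t) \<in> borel_measurable (restrict_space borel {0<..})"
    by (rule borel_measurable_mono_on_fnc)
  then have "(\<lambda>t. - (- f t)) \<in> borel_measurable (restrict_space borel {0<..})"
    by (rule borel_measurable_uminus)
  then have "(\<lambda>t. indicator {0<..} t *\<^sub>R f t) \<in> borel_measurable borel"
    by (subst (asm) borel_measurable_restrict_space_iff) auto
  then have *[measurable]: "(\<lambda>t. indicator {0<..} t * f t) \<in> borel_measurable borel"
    by simp
  have "profile = (\<lambda>t. if t = 0 then ennreal (f 0) else ennreal (indicator {0<..} t * f t))"
    by (auto simp: profile_def fun_eq_iff)
  then show ?thesis by simp
qed

lemma radial_measure_eq: "\<mu> = density (lborel_dim d) (\<lambda>y. profile (norm2 d y))"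
  unfolding radial_measure_def by (simp add: profile_def leD[OF norm2_nonneg])

lemma sets_\<mu> [measurable_cong, simp]: "sets \<mu> = sets (lborel_dim d)"
  by (simp add: radial_measure_def)

lemma space_\<mu> [simp]: "space \<mu> = space (lborel_dim d)"
  by (simp add: radial_measure_def)

sublocale \<mu>: sigma_finite_measure \<mu>
  unfolding radial_measure_eq
proof (subst lborel_dim.sigma_finite_iff_density_finite)
  show "(\<lambda>y. profile (norm2 d y)) \<in> borel_measurable (lborel_dim d)" by measurable
  show "AE y in lborel_dim d. profile (norm2 d y) \<noteq> \<infinity>" by (simp add: profile_def)
qed

text \<open>The part of \<open>\<mu>(B(0,R))\<close> in polar coordinates that does not depend on the angle.\<close>

definition radial_mass :: "real \<Rightarrow> ennreal" where
  "radial_mass R = (\<integral>\<^sup>+t\<in>{0<..R}. profile t * ennreal (real d * t ^ (d - 1)) \<partial>lborel)"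

text \<open>A cone contains the same proportion of every ball \<open>B(0,R)\<close>, and this proportion is the
  one for Lebesgue measure.\<close>

lemma emeasure_cone_ball:
  assumes C: "measurable_cone d C"
  shows "emeasure \<mu> (C \<inter> cball0 R)
    = emeasure (lborel_dim d) (C \<inter> cball0 1) * radial_mass R"
proof -
  have [measurable]: "C \<in> sets (lborel_dim d)" using C by (simp add: measurable_cone_def)
  have "emeasure \<mu> (C \<inter> cball0 R)
      = (\<integral>\<^sup>+y\<in>C. (profile (norm2 d y) * indicator {..R} (norm2 d y)) \<partial>lborel_dim d)"
    unfolding radial_measure_eq
    by (subst emeasure_density) (auto intro!: nn_integral_cong simp: eball_origin indicator_def)
  also have "\<dots> = emeasure (lborel_dim d) (C \<inter> cball0 1)
      * (\<integral>\<^sup>+t\<in>{0<..}. profile t * indicator {..R} t * ennreal (real d * t ^ (d - 1)) \<partial>lborel)"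
    by (rule nn_integral_radial_cone[OF d C]) measurable
  also have "(\<integral>\<^sup>+t\<in>{0<..}. profile t * indicator {..R} t * ennreal (real d * t ^ (d - 1)) \<partial>lborel)
      = radial_mass R"
    unfolding radial_mass_def by (intro nn_integral_cong) (auto simp: indicator_def)
  finally show ?thesis .
qed

lemma emeasure_ball0: "emeasure \<mu> (cball0 R) = unit_ball_vol d * radial_mass R"
proof -
  have "space (lborel_dim d) \<inter> cball0 r = cball0 r" for r by (auto simp: eball_def)
  then show ?thesis using emeasure_cone_ball[OF measurable_cone_space, of R] by simp
qed

text \<open>The integrability hypothesis concerns open intervals, hence the slightly larger radius,
  which is also made positive.\<close>

lemma radial_mass_finite: "radial_mass R < \<infinity>"
proof -
  let ?S = "max 1 (2 * R)"
  have "radial_mass R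
      \<le> (\<integral>\<^sup>+t. ennreal (real d) * (ennreal (f t * t ^ (d - 1)) * indicator {0<..<?S} t) \<partial>lborel)"
    unfolding radial_mass_def
    by (intro nn_integral_mono)
      (auto simp: indicator_def profile_def f_nonneg ennreal_mult'[symmetric] mult_ac)
  also have "\<dots> = (\<integral>\<^sup>+t. ennreal (real d) *
      (profile t * ennreal (t ^ (d - 1)) * indicator {0<..<?S} t) \<partial>lborel)"
    by (intro nn_integral_cong) (auto simp: indicator_def profile_def f_nonneg ennreal_mult)
  also have "\<dots> = ennreal (real d) *
      (\<integral>\<^sup>+t. profile t * ennreal (t ^ (d - 1)) * indicator {0<..<?S} t \<partial>lborel)"
    by (intro nn_integral_cmult) measurable
  also have "(\<integral>\<^sup>+t. profile t * ennreal (t ^ (d - 1)) * indicator {0<..<?S} t \<partial>lborel)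
      = (\<integral>\<^sup>+t\<in>{0<..<?S}. ennreal (f t * t ^ (d - 1)) \<partial>lborel)"
    by (intro nn_integral_cong) (auto simp: indicator_def profile_def f_nonneg ennreal_mult)
  also have "ennreal (real d) * \<dots> < \<infinity>"
    using f_locally_integrable[of ?S] by (simp add: ennreal_mult_less_top)
  finally show ?thesis .
qed

lemma radial_mass_pos:
  assumes "R > 0" shows "radial_mass R > 0"
proof -
  obtain t0 where t0: "t0 > 0" "f t0 > 0"
  proof -
    have "\<not> (\<forall>t>0. f t = 0)" using f_nonzero by auto
    then show ?thesis using that f_nonneg by (metis less_eq_real_def)
  qed
  let ?r = "min R t0"
  have "0 < ennreal (f t0) * ennreal (?r ^ d)"
    using assms t0 by (simp add: ennreal_zero_less_mult_iff)
  also have "\<dots> = ennreal (f t0) * (\<integral>\<^sup>+t\<in>{0<..?r}. ennreal (real d * t ^ (d - 1)) \<partial>lborel)"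
    using assms t0 by (subst nn_integral_power_Iic[OF d]) auto
  also have "\<dots> = (\<integral>\<^sup>+t. ennreal (f t0) * (ennreal (real d * t ^ (d - 1)) * indicator {0<..?r} t) \<partial>lborel)"
    by (intro nn_integral_cmult[symmetric]) measurable
  also have "\<dots> \<le> radial_mass R"
    unfolding radial_mass_def
  proof (intro nn_integral_mono)
    fix t
    show "ennreal (f t0) * (ennreal (real d * t ^ (d - 1)) * indicator {0<..?r} t)
        \<le> profile t * ennreal (real d * t ^ (d - 1)) * indicator {0<..R} t"
      using monotone_onD[OF f_antimono, of t t0] t0
      by (auto simp: indicator_def profile_def intro!: mult_right_mono ennreal_leI)
  qed
  finally show ?thesis .
qed

text \<open>Substituting \<open>l t\<close> for \<open>t\<close> gives the factor \<open>l\<^sup>d\<close>, and the density does not increase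
  from \<open>t\<close> to \<open>l t\<close>.\<close>

lemma radial_mass_dilate:
  assumes l: "l \<ge> 1" shows "radial_mass (l * r) \<le> ennreal (l ^ d) * radial_mass r"
proof -
  let ?G = "\<lambda>t. profile t * ennreal (real d * t ^ (d - 1)) * indicator {0<..l * r} t"
  have "radial_mass (l * r) = ennreal l * (\<integral>\<^sup>+t. ?G (0 + l * t) \<partial>lborel)"
    unfolding radial_mass_def using l by (subst nn_integral_real_affine[of _ l 0]) auto
  also have "\<dots> \<le> ennreal l * (\<integral>\<^sup>+t. ennreal (l ^ (d - 1)) *
      (profile t * ennreal (real d * t ^ (d - 1)) * indicator {0<..r} t) \<partial>lborel)"
  proof (intro mult_left_mono nn_integral_mono)
    fix t
    show "?G (0 + l * t) \<le> ennreal (l ^ (d - 1)) *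
        (profile t * ennreal (real d * t ^ (d - 1)) * indicator {0<..r} t)"
    proof (cases "0 < t \<and> t \<le> r")
      case True
      have "t \<le> l * t" using l True by simp
      then have "profile (l * t) \<le> profile t"
        using monotone_onD[OF f_antimono, of t "l * t"] True l
        by (auto simp: profile_def intro!: ennreal_leI)
      moreover have "ennreal (real d * (l * t) ^ (d - 1))
          = ennreal (l ^ (d - 1)) * ennreal (real d * t ^ (d - 1))"
        using l True by (simp add: ennreal_mult[symmetric] power_mult_distrib mult_ac)
      ultimately show ?thesis
        using True l by (auto simp: indicator_def mult_ac intro!: mult_mono)
    next
      case False
      then show ?thesis using l by (auto simp: indicator_def zero_less_mult_iff)
    qed
  qed simp
  also have "\<dots> = ennreal l * (ennreal (l ^ (d - 1)) * radial_mass r)"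
    unfolding radial_mass_def by (subst nn_integral_cmult) auto
  also have "\<dots> = ennreal (l * l ^ (d - 1)) * radial_mass r"
    using l by (simp add: ennreal_mult mult.assoc)
  also have "l * l ^ (d - 1) = l ^ d" using d by (simp add: power_eq_if)
  finally show ?thesis .
qed

definition mass :: "real \<Rightarrow> real" where
  "mass R = enn2real (emeasure \<mu> (cball0 R))"

lemma emeasure_ball0_eq_mass: "emeasure \<mu> (cball0 R) = ennreal (mass R)"
  using radial_mass_finite[of R] unit_ball_vol_finite[of d]
  by (simp add: mass_def emeasure_ball0 ennreal_mult_less_top less_top)

lemma mass_nonneg [simp]: "0 \<le> mass R"
  by (simp add: mass_def)

lemma mass_pos: "R > 0 \<Longrightarrow> 0 < mass R"
  using radial_mass_pos[of R] unit_ball_vol_pos[OF d] emeasure_ball0_eq_mass[of R]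
  by (metis emeasure_ball0 ennreal_less_zero_iff ennreal_zero_less_mult_iff)

lemma mass_mono: "R \<le> S \<Longrightarrow> mass R \<le> mass S"
proof -
  assume "R \<le> S"
  then have "cball0 R \<subseteq> cball0 S" by (auto simp: eball_def)
  then have "emeasure \<mu> (cball0 R) \<le> emeasure \<mu> (cball0 S)"
    by (intro emeasure_mono) simp_all
  then show ?thesis by (simp add: emeasure_ball0_eq_mass)
qed

lemma mass_dilate:
  assumes "l \<ge> 1" shows "mass (l * r) \<le> l ^ d * mass r"
proof -
  have "ennreal (mass (l * r)) \<le> unit_ball_vol d * (ennreal (l ^ d) * radial_mass r)"
    unfolding emeasure_ball0_eq_mass[symmetric] emeasure_ball0
    by (intro mult_left_mono radial_mass_dilate assms) simp
  also have "\<dots> = ennreal (l ^ d * mass r)"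
    using assms by (simp add: ennreal_mult emeasure_ball0_eq_mass[symmetric] emeasure_ball0 mult_ac)
  finally show ?thesis using assms by simp
qed

lemma cap_mass_le:
  assumes "norm2 d e \<le> 1" "0 \<le> c" "c\<^sup>2 \<le> 1 / 2"
  shows "emeasure \<mu> (cap_cone d e c \<inter> cball0 R) \<le> ennreal (sqrt (1 - c\<^sup>2) ^ d * mass R)"
proof -
  have "emeasure \<mu> (cap_cone d e c \<inter> cball0 R)
      \<le> ennreal (sqrt (1 - c\<^sup>2) ^ d) * unit_ball_vol d * radial_mass R"
    unfolding emeasure_cone_ball[OF measurable_cone_cap_cone]
    by (intro mult_right_mono cap_cone_unit_ball_le assms) simp
  also have "\<dots> = ennreal (sqrt (1 - c\<^sup>2) ^ d * mass R)"
    using assms by (simp add: ennreal_mult emeasure_ball0_eq_mass[symmetric] emeasure_ball0 mult_ac)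
  finally show ?thesis .
qed

lemma half_ball_mass_ge:
  "ennreal (mass R / 2) \<le> emeasure \<mu> (cap_cone d e 0 \<inter> cball0 R)"
proof -
  have "ennreal (mass R) \<le> 2 * emeasure \<mu> (cap_cone d e 0 \<inter> cball0 R)"
    unfolding emeasure_ball0_eq_mass[symmetric] emeasure_ball0
      emeasure_cone_ball[OF measurable_cone_cap_cone] mult.assoc[symmetric]
    by (intro mult_right_mono half_space_unit_ball_ge) simp
  then show ?thesis
    by (cases "emeasure \<mu> (cap_cone d e 0 \<inter> cball0 R)")
      (auto simp: ennreal_mult[symmetric] simp flip: ennreal_numeral)
qed

section \<open>Choice of the radius\<close>

lemma ball_ratio_eq:
  assumes "R > 0" "u > 0"
  shows "ball_ratio d \<mu> u R = ennreal (mass R / mass (u * R))"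
  using assms mass_pos[of "u * R"]
  by (simp add: ball_ratio_def emeasure_ball0_eq_mass divide_ennreal)

text \<open>If the ratio \<open>h(R) = m(R)/m(uR)\<close> never exceeds \<open>2V\<close>, any radius with \<open>h > V/2\<close>
  does the job. Otherwise the radii with \<open>h > 2V\<close> are bounded, because of the
  hypothesis at infinity, and a radius slightly beyond their supremum is chosen. The ratio is
  still large there: a dilation by \<open>l\<close> changes \<open>m\<close> by at most \<open>l\<^sup>d\<close>, which replaces an
  argument by continuity.\<close>

lemma radius_with_critical_growth:
  assumes u: "0 < u" and V: "V > 0"
    and sup: "(SUP R\<in>{0<..}. ball_ratio d \<mu> u R) \<ge> ennreal V"
    and lim: "Limsup at_top (ball_ratio d \<mu> u) \<le> ennreal V"
  obtains R where "R > 0" "V / 2 * mass (u * R) \<le> mass R"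
    "\<And>S. S \<ge> R \<Longrightarrow> mass S \<le> 2 * V * mass (u * S)"
proof -
  define h where "h R = mass R / mass (u * R)" for R
  have h_ge: "x \<le> h R \<longleftrightarrow> x * mass (u * R) \<le> mass R" if "R > 0" for x R
    using mass_pos[of "u * R"] that u by (simp add: h_def pos_le_divide_eq)
  have h_le: "h R \<le> x \<longleftrightarrow> mass R \<le> x * mass (u * R)" if "R > 0" for x R
    using mass_pos[of "u * R"] that u by (simp add: h_def pos_divide_le_eq)
  define T where "T = {R. R > 0 \<and> h R > 2 * V}"
  have "\<exists>R>0. V / 2 \<le> h R \<and> (\<forall>S\<ge>R. h S \<le> 2 * V)"
  proof (cases "T = {}")
    case True
    have "ennreal (V / 2) < (SUP R\<in>{0<..}. ball_ratio d \<mu> u R)"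
      using sup V by (intro less_le_trans[OF _ sup] ennreal_lessI) auto
    then obtain R where R: "R > 0" "ennreal (V / 2) < ball_ratio d \<mu> u R"
      by (auto simp: less_SUP_iff)
    then have "V / 2 \<le> h R"
      using V u by (auto simp: ball_ratio_eq h_def ennreal_less_iff)
    moreover have "h S \<le> 2 * V" if "S \<ge> R" for S
      using True that R(1) by (force simp: T_def not_less)
    ultimately show ?thesis using R(1) by blast
  next
    case False
    have "Limsup at_top (ball_ratio d \<mu> u) < ennreal (2 * V)"
      using V by (intro le_less_trans[OF lim] ennreal_lessI) auto
    then obtain N where N: "\<And>R. R \<ge> N \<Longrightarrow> ball_ratio d \<mu> u R < ennreal (2 * V)"
      using Limsup_lessD[of at_top "ball_ratio d \<mu> u"] unfolding eventually_at_top_linorder by metis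
    have bdd: "R \<le> N" if "R \<in> T" for R
    proof (rule ccontr)
      assume "\<not> R \<le> N"
      then have "ball_ratio d \<mu> u R < ennreal (2 * V)" by (intro N) auto
      then show False
        using that u V by (auto simp: T_def ball_ratio_eq h_def ennreal_less_iff)
    qed
    then have bddT: "bdd_above T" by (auto simp: bdd_above_def)
    \<comment> \<open>The dilation factor is chosen such that two dilations by it cost a factor \<open>4\<close> in measure.\<close>
    define l where "l = root d 2"
    have l: "l > 1" "l ^ d = 2" using d by (auto simp: l_def)
    have SupT: "Sup T > 0"
      using False cSup_upper[OF _ bddT] by (force simp: T_def)
    have "Sup T / l < Sup T" using l SupT by (simp add: pos_divide_less_eq)
    then obtain s where s: "s \<in> T" "Sup T / l < s"
      using less_cSup_iff[OF False bddT] by blast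
    define R where "R = l * Sup T"
    have s0: "s > 0" and hs: "2 * V \<le> h s" using s by (auto simp: T_def)
    have R0: "R > 0" and sR: "s \<le> R" and Rs: "R \<le> l * l * s"
    proof -
      show "R > 0" using SupT l by (simp add: R_def)
      show "s \<le> R" using cSup_upper[OF s(1) bddT] l SupT unfolding R_def
        by (metis less_eq_real_def mult_le_cancel_right1 not_le order_trans)
      have "Sup T \<le> l * s" using s(2) l by (simp add: pos_divide_less_eq mult.commute)
      then show "R \<le> l * l * s" using l by (simp add: R_def mult.assoc)
    qed
    have "V / 2 * mass (u * R) \<le> V / 2 * mass (l * l * (u * s))"
      using Rs u V by (intro mult_left_mono mass_mono) (auto simp: mult_ac)
    also have "\<dots> \<le> V / 2 * ((l * l) ^ d * mass (u * s))"
      using l V by (intro mult_left_mono mass_dilate) (auto simp: less_1_mult less_imp_le)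
    also have "\<dots> = 2 * V * mass (u * s)"
      using l by (simp add: power_mult_distrib)
    also have "\<dots> \<le> mass s" using hs h_ge[OF s0] by simp
    also have "\<dots> \<le> mass R" using sR by (rule mass_mono)
    finally have "V / 2 \<le> h R" using h_ge[OF R0] by simp
    moreover have "h S \<le> 2 * V" if "S \<ge> R" for S
    proof -
      have "Sup T < R" using l SupT by (simp add: R_def)
      then have "S \<notin> T" using cSup_upper[OF _ bddT] that by force
      then show ?thesis using that R0 by (auto simp: T_def)
    qed
    ultimately show ?thesis using R0 by blast
  qed
  then obtain R where R: "R > 0" "V / 2 \<le> h R" "\<And>S. S \<ge> R \<Longrightarrow> h S \<le> 2 * V" by blast
  then show ?thesis
    using h_ge[OF R(1), THEN iffD1, OF R(2)] h_le by (intro that[OF R(1)]) auto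
qed

end

section \<open>Measurability of the maximal function\<close>

lemma norm2_triangle: "norm2 d y \<le> norm2 d (\<lambda>i. y i - x i) + norm2 d x"
  using L2_set_triangle_ineq[of "\<lambda>i. y i - x i" x "{..<d}"] by (simp add: norm2_def)

context radial_decreasing
begin

lemma emeasure_eball_finite: "emeasure \<mu> (eball d x r) < \<infinity>"
proof -
  have "norm2 d y \<le> r + norm2 d x" if "norm2 d (\<lambda>i. y i - x i) \<le> r" for y
    using norm2_triangle[of d y x] that by simp
  then have "eball d x r \<subseteq> cball0 (r + norm2 d x)"
    unfolding eball_origin by (auto simp: eball_def)
  then have "emeasure \<mu> (eball d x r) \<le> ennreal (mass (r + norm2 d x))"
    unfolding emeasure_ball0_eq_mass[symmetric] by (intro emeasure_mono) simp_all
  then show ?thesis using le_less_trans by fastforce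
qed

lemma measurable_ball_integral:
  assumes [measurable]: "G \<in> borel_measurable (lborel_dim d)"
  shows "(\<lambda>x. \<integral>\<^sup>+y\<in>eball d x r. G y \<partial>\<mu>) \<in> borel_measurable (lborel_dim d)"
proof -
  have [measurable]: "G \<in> borel_measurable \<mu>" by simp
  have "(\<lambda>y. y i) \<in> borel_measurable \<mu>" if "i < d" for i
    by (subst measurable_cong_sets[OF sets_\<mu> refl]) (rule measurable_coord[OF that])
  then have "(\<lambda>w. norm2 d (\<lambda>i. snd w i - fst w i)) \<in> borel_measurable (lborel_dim d \<Otimes>\<^sub>M \<mu>)"
    by (intro measurable_norm2_compose borel_measurable_diff
        measurable_compose[OF measurable_fst] measurable_compose[OF measurable_snd])
      (auto intro: measurable_coord)
  then have [measurable]: "(\<lambda>(x, y). norm2 d (\<lambda>i. y i - x i)) \<in> borel_measurable (lborel_dim d \<Otimes>\<^sub>M \<mu>)"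
    by (simp add: case_prod_beta')
  have "(\<lambda>x. \<integral>\<^sup>+y. G y * indicator {..r} (norm2 d (\<lambda>i. y i - x i)) \<partial>\<mu>)
      \<in> borel_measurable (lborel_dim d)"
    by (intro \<mu>.borel_measurable_nn_integral) measurable
  moreover have "(\<integral>\<^sup>+y. G y * indicator {..r} (norm2 d (\<lambda>i. y i - x i)) \<partial>\<mu>)
      = (\<integral>\<^sup>+y\<in>eball d x r. G y \<partial>\<mu>)" for x
    by (intro nn_integral_cong) (auto simp: indicator_def eball_def)
  ultimately show ?thesis by simp
qed

text \<open>The weak type inequality is about the measure of a level set, so the maximal function has to
  be measurable. Rational radii are enough, because \<open>\<mu>(B(x,r))\<close> is continuous from the right
  in \<open>r\<close> (the balls are closed and have finite measure) and the numerator is monotone in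
  \<open>r\<close>.\<close>

lemma HL_maximal_eq_SUP_rational:
  "HL_maximal d \<mu> g x = (SUP q\<in>{q\<in>\<rat>. q > 0}. if emeasure \<mu> (eball d x q) > 0
      then (\<integral>\<^sup>+y\<in>eball d x q. ennreal \<bar>g y\<bar> \<partial>\<mu>) / emeasure \<mu> (eball d x q) else 0)"
  (is "_ = ?S")
proof (rule antisym)
  let ?N = "\<lambda>r. \<integral>\<^sup>+y\<in>eball d x r. ennreal \<bar>g y\<bar> \<partial>\<mu>" and ?D = "\<lambda>r. emeasure \<mu> (eball d x r)"
  show "?S \<le> HL_maximal d \<mu> g x"
    unfolding HL_maximal_def by (intro SUP_least) (auto intro: SUP_upper)
  show "HL_maximal d \<mu> g x \<le> ?S"
    unfolding HL_maximal_def
  proof (intro SUP_least)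
    fix r assume "r \<in> {r. r > 0 \<and> ?D r > 0}"
    then have r: "r > 0" "?D r > 0" by auto
    have mono: "eball d x a \<subseteq> eball d x b" if "a \<le> b" for a b
      using that by (auto simp: eball_def)
    have bound: "?N r \<le> ?S * ?D (r + 1 / real (Suc n))" for n
    proof -
      obtain q where q: "q \<in> \<rat>" "r < q" "q < r + 1 / real (Suc n)"
        using Rats_dense_in_real[of r "r + 1 / real (Suc n)"] by auto
      have Dq: "?D q > 0" "?D q \<noteq> 0" "?D q \<noteq> \<infinity>"
        using r(2) emeasure_mono[OF mono[of r q], of \<mu>] q emeasure_eball_finite[of x q]
        by (auto simp: less_top intro: less_le_trans)
      have "?N r \<le> ?N q"
        using mono[of r q] q by (intro nn_integral_mono) (auto simp: indicator_def)
      also have "\<dots> = ?N q / ?D q * ?D q"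
        using Dq by (simp add: ennreal_divide_times ennreal_divide_self less_top)
      also have "\<dots> \<le> ?S * ?D q"
        using q r Dq by (intro mult_right_mono SUP_upper2[of q]) auto
      also have "\<dots> \<le> ?S * ?D (r + 1 / real (Suc n))"
        using mono[of q "r + 1 / real (Suc n)"] q by (intro mult_left_mono emeasure_mono) auto
      finally show ?thesis .
    qed
    show "?N r / ?D r \<le> ?S"
    proof (cases "?S = \<infinity>")
      case True
      show ?thesis unfolding True by simp
    next
      case False
      have "(\<lambda>n. ?D (r + 1 / real (Suc n))) \<longlonglongrightarrow> emeasure \<mu> (\<Inter>n. eball d x (r + 1 / real (Suc n)))"
      proof (rule Lim_emeasure_decseq)
        show "decseq (\<lambda>n. eball d x (r + 1 / real (Suc n)))"
          by (intro decseq_SucI mono) (simp add: field_simps)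
      qed (use emeasure_eball_finite in \<open>auto simp: less_top\<close>)
      also have "(\<Inter>n. eball d x (r + 1 / real (Suc n))) = eball d x r"
      proof (intro equalityI INT_greatest mono subsetI)
        fix y assume y: "y \<in> (\<Inter>n. eball d x (r + 1 / real (Suc n)))"
        have "norm2 d (\<lambda>i. y i - x i) \<le> r"
        proof (rule LIMSEQ_le_const)
          show "(\<lambda>n. r + 1 / real (Suc n)) \<longlonglongrightarrow> r"
            using tendsto_add[OF tendsto_const[of r] LIMSEQ_Suc[OF lim_1_over_n]] by simp
          show "\<exists>N. \<forall>n\<ge>N. norm2 d (\<lambda>i. y i - x i) \<le> r + 1 / real (Suc n)"
            using y by (auto simp: eball_def)
        qed
        then show "y \<in> eball d x r" using y by (auto simp: eball_def)
      qed auto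
      finally have "(\<lambda>n. ?S * ?D (r + 1 / real (Suc n))) \<longlonglongrightarrow> ?S * ?D r"
        using False[unfolded infinity_ennreal_def] top.not_eq_extremum[THEN iffD1]
        by (intro ennreal_tendsto_cmult)
      then have "?N r \<le> ?S * ?D r"
        by (rule LIMSEQ_le_const) (use bound in auto)
      then show ?thesis
        using r by (intro divide_le_posI_ennreal) (auto simp: mult.commute)
    qed
  qed
qed

lemma measurable_HL_maximal:
  assumes "g \<in> borel_measurable (lborel_dim d)"
  shows "HL_maximal d \<mu> g \<in> borel_measurable (lborel_dim d)"
proof -
  have N[measurable]: "(\<lambda>x. \<integral>\<^sup>+y\<in>eball d x q. ennreal \<bar>g y\<bar> \<partial>\<mu>) \<in> borel_measurable (lborel_dim d)" for q
    using assms by (intro measurable_ball_integral) measurable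
  have D[measurable]: "(\<lambda>x. emeasure \<mu> (eball d x q)) \<in> borel_measurable (lborel_dim d)" for q
    using measurable_ball_integral[of "\<lambda>_. 1" q] by simp
  have "countable {q \<in> \<rat>. q > (0::real)}"
    by (rule countable_subset[OF _ countable_rat]) auto
  then show ?thesis
    unfolding HL_maximal_eq_SUP_rational by (intro borel_measurable_SUP) measurable
qed

section \<open>Measures of the averaging balls\<close>

text \<open>Points of the averaging ball satisfy \<open>|y|\<^sup>2 - \<rho>\<^sup>2 \<le> 2 x \<bullet> y\<close>. Dividing by \<open>2R|y|\<close> bounds
  \<open>(x/R) \<bullet> (y/|y|)\<close> below by an increasing function of \<open>|y|\<close>, so its value at the inner radius \<open>tR\<close> of a
  shell serves for the whole shell. The number \<open>9/50\<close> is a rational upper bound of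
  \<open>(2/3) 55\<^sup>-\<^sup>1\<^sup>/\<^sup>3 = 0.1753...\<close>, the value of
  \<open>(\<rho>/R)\<^sup>2\<close> for \<open>\<rho> = b u R\<close>.\<close>

lemma eball_shell_subset_cap:
  assumes R: "R > 0" and x: "norm2 d x \<le> R" and \<rho>: "\<rho>\<^sup>2 \<le> 9 / 50 * R\<^sup>2" and t: "t > 0"
    and y: "y \<in> eball d x (sqrt ((norm2 d x)\<^sup>2 + \<rho>\<^sup>2))" "t * R \<le> norm2 d y"
  shows "y \<in> cap_cone d (\<lambda>i. (1 / R) * x i) ((t\<^sup>2 - 9 / 50) / (2 * t))"
proof -
  define n where "n = norm2 d y"
  have n: "t * R \<le> n" "0 < n" using y(2) R t by (auto simp: n_def intro: less_le_trans[of 0 "t * R"])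
  have "norm2 d (\<lambda>i. y i - x i) \<le> sqrt ((norm2 d x)\<^sup>2 + \<rho>\<^sup>2)"
    using y(1) by (simp add: eball_def)
  then have "(norm2 d (\<lambda>i. y i - x i))\<^sup>2 \<le> (norm2 d x)\<^sup>2 + \<rho>\<^sup>2"
    by (metis norm2_nonneg power_mono real_sqrt_pow2 sum_power2_ge_zero)
  then have "n\<^sup>2 - 9 / 50 * R\<^sup>2 \<le> 2 * dot d x y"
    using \<rho> unfolding norm2_diff_square n_def by simp
  moreover have "(t\<^sup>2 - 9 / 50) * R * n \<le> t * (n\<^sup>2 - 9 / 50 * R\<^sup>2)"
  proof -
    have "0 \<le> (n - t * R) * (t * n + 9 / 50 * R)"
      using n t R by (intro mult_nonneg_nonneg) auto
    moreover have "t * (n\<^sup>2 - 9 / 50 * R\<^sup>2) - (t\<^sup>2 - 9 / 50) * R * n = (n - t * R) * (t * n + 9 / 50 * R)"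
      by (simp add: power2_eq_square field_simps)
    ultimately show ?thesis by linarith
  qed
  ultimately have "(t\<^sup>2 - 9 / 50) * R * n \<le> t * (2 * dot d x y)"
    using t by (meson less_eq_real_def mult_left_mono order_trans)
  then have "(t\<^sup>2 - 9 / 50) / (2 * t) * n \<le> (1 / R) * dot d x y"
    using t R by (simp add: field_simps)
  moreover have "dot d (\<lambda>i. (1 / R) * x i) y = (1 / R) * dot d x y"
    by (simp add: dot_def sum_divide_distrib)
  ultimately show ?thesis using y(1) by (simp add: cap_cone_def eball_def n_def)
qed

text \<open>Outside \<open>B(0,uR)\<close> the ball is cut at the radii \<open>R\<close> and \<open>R/u\<close> into three shells with inner
  radii \<open>tR\<close>, \<open>t = u, 1, 1/u\<close>. The last one ends at \<open>R/u\<^sup>4 = 9R/4\<close>, beyond which there is no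
  point of the ball. Each shell lies in a cone, whose sine is the square root in the statement, and
  in a ball whose measure is at most \<open>m(uR)\<close> times a power of the growth factor \<open>W\<close>. A single shell
  would not do: the growth up to \<open>9R/4\<close> is too large for the wide cone at \<open>t = u\<close>.\<close>

lemma averaging_ball_mass_le:
  assumes u: "u = sqrt (2 / 3)" and R: "R > 0" and W: "W \<ge> 0"
    and growth: "\<And>S. S \<ge> R \<Longrightarrow> mass S \<le> W * mass (u * S)"
    and x: "norm2 d x \<le> R" and \<rho>: "\<rho>\<^sup>2 \<le> 9 / 50 * R\<^sup>2"
  shows "emeasure \<mu> (eball d x (sqrt ((norm2 d x)\<^sup>2 + \<rho>\<^sup>2)))
    \<le> ennreal (mass (u * R) * (1 + W * sqrt (54671 / 60000) ^ d
        + W\<^sup>2 * sqrt (8319 / 10000) ^ d + W ^ 5 * sqrt (887 / 1250) ^ d))"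
    (is "emeasure \<mu> ?B \<le> _")
proof -
  have u0: "u > 0" "u \<le> 1" "u\<^sup>2 = 2 / 3" by (auto simp: u)
  define e where "e = (\<lambda>i. (1 / R) * x i)"
  have e: "norm2 d e \<le> 1" using x R unfolding e_def norm2_scale by simp
  define c where "c t = (t\<^sup>2 - 9 / 50) / (2 * t)" for t :: real
  have cone: "y \<in> cap_cone d e (c t)" if "y \<in> ?B" "t * R \<le> norm2 d y" "t > 0" for y t
    using eball_shell_subset_cap[OF R x \<rho> that(3,1,2)] by (simp add: e_def c_def)
  have c_sq: "0 \<le> c u" "(c u)\<^sup>2 = 5329 / 60000" "0 \<le> c 1" "(c 1)\<^sup>2 = 1681 / 10000"
    "0 \<le> c (1 / u)" "(c (1 / u))\<^sup>2 = 363 / 1250"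
    using u0(1) by (simp_all add: c_def power_divide power_mult_distrib u0(3))
  have mass_iter: "mass (R / u ^ k) \<le> W ^ Suc k * mass (u * R)" for k
  proof (induction k)
    case 0 then show ?case using growth[of R] by simp
  next
    case (Suc k)
    have "R \<le> R / u ^ Suc k"
      using R u0 power_le_one[of u "Suc k"] by (simp add: pos_le_divide_eq mult_left_le)
    then have "mass (R / u ^ Suc k) \<le> W * mass (u * (R / u ^ Suc k))" by (rule growth)
    also have "u * (R / u ^ Suc k) = R / u ^ k" using u0 by simp
    also have "W * mass (R / u ^ k) \<le> W * (W ^ Suc k * mass (u * R))"
      using Suc W by (intro mult_left_mono)
    finally show ?case by (simp add: mult_ac)
  qed
  have cap: "emeasure \<mu> (cap_cone d e (c t) \<inter> cball0 (R / u ^ k))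
      \<le> ennreal (mass (u * R) * (W ^ Suc k * sqrt (1 - (c t)\<^sup>2) ^ d))"
    if "0 \<le> c t" "(c t)\<^sup>2 \<le> 1 / 2" for t k
  proof -
    have "sqrt (1 - (c t)\<^sup>2) ^ d * mass (R / u ^ k)
        \<le> sqrt (1 - (c t)\<^sup>2) ^ d * (W ^ Suc k * mass (u * R))"
      using that by (intro mult_left_mono mass_iter) auto
    then show ?thesis
      by (intro order_trans[OF cap_mass_le[OF e that]] ennreal_leI) (simp add: mult_ac)
  qed
  let ?A0 = "cball0 (u * R)" and ?A1 = "cap_cone d e (c u) \<inter> cball0 (R / u ^ 0)"
    and ?A2 = "cap_cone d e (c 1) \<inter> cball0 (R / u ^ 1)"
    and ?A3 = "cap_cone d e (c (1 / u)) \<inter> cball0 (R / u ^ 4)"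
  have sets: "cap_cone d e s \<inter> cball0 T \<in> sets \<mu>" for s T
    using measurable_cone_cap_cone[of d e s] by (auto simp: measurable_cone_def)
  have far: "norm2 d y \<le> R / u ^ 4" if "y \<in> ?B" for y
  proof -
    have u4: "u ^ 4 = 4 / 9" using power_mult[of u 2 2] by (simp add: u0(3) power_divide)
    have "R / u ^ 4 = 9 / 4 * R" unfolding u4 by simp
    moreover have "norm2 d y \<le> sqrt ((norm2 d x)\<^sup>2 + \<rho>\<^sup>2) + norm2 d x"
      using norm2_triangle[of d y x] that by (simp add: eball_def)
    moreover have "sqrt ((norm2 d x)\<^sup>2 + \<rho>\<^sup>2) \<le> 5 / 4 * R"
    proof (rule real_le_lsqrt)
      show "(norm2 d x)\<^sup>2 + \<rho>\<^sup>2 \<le> (5 / 4 * R)\<^sup>2"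
        using power_mono[OF x norm2_nonneg, of 2] \<rho> zero_le_power2[of R]
        unfolding power_mult_distrib power2_eq_square[of "5 / 4"] by linarith
    qed (use R in auto)
    ultimately show ?thesis using x by linarith
  qed
  have "?B \<subseteq> ?A0 \<union> (?A1 \<union> (?A2 \<union> ?A3))"
  proof
    fix y assume y: "y \<in> ?B"
    then have ys: "y \<in> space (lborel_dim d)" by (simp add: eball_def)
    consider "norm2 d y \<le> u * R" | "u * R \<le> norm2 d y" "norm2 d y \<le> R"
      | "1 * R \<le> norm2 d y" "norm2 d y \<le> R / u" | "1 / u * R \<le> norm2 d y" by fastforce
    then show "y \<in> ?A0 \<union> (?A1 \<union> (?A2 \<union> ?A3))"
      by cases (use y ys cone u0 far in \<open>auto simp: eball_origin\<close>)
  qed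
  then have "emeasure \<mu> ?B \<le> emeasure \<mu> (?A0 \<union> (?A1 \<union> (?A2 \<union> ?A3)))"
    using sets by (intro emeasure_mono) auto
  also have "\<dots> \<le> emeasure \<mu> ?A0 + (emeasure \<mu> ?A1 + (emeasure \<mu> ?A2 + emeasure \<mu> ?A3))"
    using sets by (intro order_trans[OF emeasure_subadditive] add_left_mono) auto
  also have "\<dots> \<le> ennreal (mass (u * R)) + (ennreal (mass (u * R) * (W ^ Suc 0 * sqrt (1 - (c u)\<^sup>2) ^ d))
      + (ennreal (mass (u * R) * (W ^ Suc 1 * sqrt (1 - (c 1)\<^sup>2) ^ d))
      + ennreal (mass (u * R) * (W ^ Suc 4 * sqrt (1 - (c (1 / u))\<^sup>2) ^ d))))"
    using c_sq by (intro add_mono cap) (simp_all add: emeasure_ball0_eq_mass)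
  also have "\<dots> = ennreal (mass (u * R) * (1 + W * sqrt (54671 / 60000) ^ d
        + W\<^sup>2 * sqrt (8319 / 10000) ^ d + W ^ 5 * sqrt (887 / 1250) ^ d))"
    unfolding c_sq(2,4,6) using W by (simp add: ennreal_plus[symmetric] power2_eq_square distrib_left mult_ac add_ac numeral_2_eq_2 del: ennreal_plus)
  finally show ?thesis .
qed

end

section \<open>Weak and strong type constants\<close>

lemma ennreal_powr_ennreal: "a \<ge> 0 \<Longrightarrow> ennreal_powr (ennreal a) p = ennreal (a powr p)"
  by (simp add: ennreal_powr_def)

lemma ennreal_powr_mono: "x \<le> y \<Longrightarrow> p \<ge> 0 \<Longrightarrow> ennreal_powr x p \<le> ennreal_powr y p"
  by (cases x; cases y) (auto simp: ennreal_powr_def top_unique intro!: ennreal_leI powr_mono2)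

lemma ennreal_powr_inverse: "p > 0 \<Longrightarrow> ennreal_powr (ennreal_powr x (1 / p)) p = x"
  by (cases x) (auto simp: ennreal_powr_def powr_powr)

lemma ennreal_powr_divide:
  assumes "\<alpha> > 0"
  shows "ennreal_powr (x / ennreal \<alpha>) p = ennreal_powr x p / ennreal (\<alpha> powr p)"
proof (cases x)
  case (real r)
  then show ?thesis
    using assms by (simp add: ennreal_powr_ennreal divide_ennreal powr_divide)
next
  case top
  then show ?thesis using assms by (simp add: ennreal_powr_def ennreal_top_divide)
qed

text \<open>Chebyshev's inequality. A level set of the maximal function that is not measurable has
  measure \<open>0\<close> by convention, and the inequality is then trivial.\<close>

lemma weak_type_const_le_strong_type_const:
  assumes p: "p \<ge> 1"
  shows "weak_type_const p d \<mu> \<le> strong_type_const p d \<mu>"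
  unfolding weak_type_const_def strong_type_const_def
proof (intro Inf_superset_mono subsetI CollectI ballI allI impI)
  fix C g and \<alpha> :: real
  assume C: "C \<in> {C. \<forall>g\<in>Lp_space \<mu> p. Lp_norm \<mu> p (HL_maximal d \<mu> g) \<le> C * Lp_norm \<mu> p (\<lambda>x. ennreal \<bar>g x\<bar>)}"
    and g: "g \<in> Lp_space \<mu> p" and \<alpha>: "0 < \<alpha>"
  let ?S = "{x \<in> space \<mu>. ennreal \<alpha> \<le> HL_maximal d \<mu> g x}"
  let ?I = "\<integral>\<^sup>+x. ennreal_powr (HL_maximal d \<mu> g x) p \<partial>\<mu>"
  let ?N = "C * Lp_norm \<mu> p (\<lambda>x. ennreal \<bar>g x\<bar>)"
  show "emeasure \<mu> ?S \<le> ennreal_powr (?N / ennreal \<alpha>) p"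
  proof (cases "?S \<in> sets \<mu>")
    case True
    have "ennreal (\<alpha> powr p) * emeasure \<mu> ?S = (\<integral>\<^sup>+x. ennreal (\<alpha> powr p) * indicator ?S x \<partial>\<mu>)"
      using True by (simp add: nn_integral_cmult_indicator)
    also have "\<dots> \<le> ?I"
    proof (intro nn_integral_mono)
      fix x
      have "ennreal (\<alpha> powr p) \<le> ennreal_powr (HL_maximal d \<mu> g x) p" if "x \<in> ?S"
        using ennreal_powr_mono[of "ennreal \<alpha>" "HL_maximal d \<mu> g x" p] that p \<alpha>
        by (simp add: ennreal_powr_ennreal)
      then show "ennreal (\<alpha> powr p) * indicator ?S x \<le> ennreal_powr (HL_maximal d \<mu> g x) p"
        by (simp add: indicator_def)
    qed
    also have "?I = ennreal_powr (Lp_norm \<mu> p (HL_maximal d \<mu> g)) p"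
      using p by (simp add: Lp_norm_def ennreal_powr_inverse)
    also have "\<dots> \<le> ennreal_powr ?N p"
      using C g p by (intro ennreal_powr_mono) auto
    finally have "emeasure \<mu> ?S * ennreal (\<alpha> powr p) \<le> ennreal_powr ?N p"
      by (simp add: mult.commute)
    then have "emeasure \<mu> ?S * ennreal (\<alpha> powr p) / ennreal (\<alpha> powr p)
        \<le> ennreal_powr ?N p / ennreal (\<alpha> powr p)"
      by (rule divide_right_mono_ennreal)
    then have "emeasure \<mu> ?S \<le> ennreal_powr ?N p / ennreal (\<alpha> powr p)"
      using \<alpha> by (simp add: ennreal_mult_divide_eq)
    then show ?thesis using \<alpha> by (simp add: ennreal_powr_divide)
  qed (simp add: emeasure_notin_sets)
qed

text \<open>Here \<open>v\<^sup>6 = 64/55\<close>, so the sixth powers of both sides are rational; the three square roots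
  are the sines of the caps in the previous section.\<close>

lemma growth_times_cap_le:
  assumes "v = (64 / 55) powr (1 / 6)"
  shows "v * sqrt (54671 / 60000) \<le> 99 / 100" "v\<^sup>2 * sqrt (8319 / 10000) \<le> 99 / 100"
    "v ^ 5 * sqrt (887 / 1250) \<le> 99 / 100"
proof -
  have v0: "v > 0" and v6: "v ^ 6 = 64 / 55"
    using assms by (auto simp: powr_realpow[symmetric] powr_powr)
  have root: "v ^ k * sqrt s \<le> 99 / 100" if "(64 / 55) ^ k * s ^ 3 \<le> (99 / 100) ^ 6" "s \<ge> 0" for k s
  proof (rule power_le_imp_le_base[where n = 5])
    have "sqrt s ^ 6 = s ^ 3" using that power_mult[of "sqrt s" 2 3] by simp
    moreover have "(v ^ k) ^ 6 = (64 / 55) ^ k" by (metis power_commutes power_mult mult.commute v6)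
    ultimately show "(v ^ k * sqrt s) ^ Suc 5 \<le> (99 / 100) ^ Suc 5"
      using that by (simp add: power_mult_distrib)
  qed simp
  have "v ^ 1 * sqrt (54671 / 60000) \<le> 99 / 100" by (rule root) (simp_all add: power_divide)
  then show "v * sqrt (54671 / 60000) \<le> 99 / 100" by simp
  show "v\<^sup>2 * sqrt (8319 / 10000) \<le> 99 / 100" by (rule root) (simp_all add: power_divide)
  show "v ^ 5 * sqrt (887 / 1250) \<le> 99 / 100" by (rule root) (simp_all add: power_divide)
qed

text \<open>The growth factor is \<open>2 v\<^sup>d\<close>, whose first, second and fifth powers contribute
  \<open>2 + 4 + 32 = 38\<close>.\<close>

lemma cap_sum_le:
  fixes d :: nat
  assumes v: "v = (64 / 55) powr (1 / 6)"
  shows "1 + 2 * v ^ d * sqrt (54671 / 60000) ^ d + (2 * v ^ d)\<^sup>2 * sqrt (8319 / 10000) ^ d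
      + (2 * v ^ d) ^ 5 * sqrt (887 / 1250) ^ d \<le> 1 + 38 * (99 / 100) ^ d"
proof -
  have v0: "v > 0" using v by simp
  have "2 * v ^ d * sqrt (54671 / 60000) ^ d = 2 * (v * sqrt (54671 / 60000)) ^ d"
    by (simp add: power_mult_distrib)
  moreover have "(2 * v ^ d)\<^sup>2 * sqrt (8319 / 10000) ^ d = 4 * (v\<^sup>2 * sqrt (8319 / 10000)) ^ d"
    by (simp only: power_mult_distrib power_mult[symmetric] mult.commute[of d]) simp
  moreover have "(2 * v ^ d) ^ 5 * sqrt (887 / 1250) ^ d = 32 * (v ^ 5 * sqrt (887 / 1250)) ^ d"
    by (simp only: power_mult_distrib power_mult[symmetric] mult.commute[of d]) simp
  moreover have "(v * sqrt (54671 / 60000)) ^ d \<le> (99 / 100) ^ d"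
    "(v\<^sup>2 * sqrt (8319 / 10000)) ^ d \<le> (99 / 100) ^ d"
    "(v ^ 5 * sqrt (887 / 1250)) ^ d \<le> (99 / 100) ^ d"
    using growth_times_cap_le[OF v] v0 by (auto intro!: power_mono)
  ultimately show ?thesis by linarith
qed

text \<open>Bernoulli's inequality for \<open>1 + 1/100 \<le> 100/99\<close> bounds the geometric term by
  \<open>100/d\<close>.\<close>

lemma geometric_le_inverse_sqrt:
  assumes d: "d \<ge> 1"
  shows "152 * (99 / 100) ^ d \<le> 15200 / sqrt (real d)"
proof -
  have "(99 / 100 :: real) ^ d * (1 + real d * (1 / 100)) \<le> (99 / 100) ^ d * (1 + 1 / 100) ^ d"
    using Bernoulli_inequality[of "1 / 100 :: real" d] by (intro mult_left_mono) auto
  also have "\<dots> = (99 / 100 * (1 + 1 / 100)) ^ d" by (rule power_mult_distrib[symmetric])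
  also have "\<dots> \<le> 1" by (rule power_le_one) auto
  finally have "(99 / 100 :: real) ^ d * (1 + real d * (1 / 100)) \<le> 1" .
  moreover have "sqrt (real d) / 100 \<le> 1 + real d * (1 / 100)"
  proof -
    have "sqrt (real d) \<le> sqrt (real d) * sqrt (real d)"
      using d mult_left_mono[of 1 "sqrt (real d)" "sqrt (real d)"] by simp
    then show ?thesis by simp
  qed
  ultimately have "(99 / 100 :: real) ^ d * (sqrt (real d) / 100) \<le> 1"
    by (meson mult_left_mono order_trans zero_le_power zero_le_divide_iff zero_le_numeral)
  then show ?thesis using d by (simp add: field_simps)
qed

context radial_decreasing
begin

lemma Lp_norm_indicator_ball:
  assumes "p > 0"
  shows "Lp_norm \<mu> p (\<lambda>x. ennreal \<bar>indicator (cball0 \<rho>) x\<bar>) = ennreal (mass \<rho> powr (1 / p))"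
proof -
  have "(\<integral>\<^sup>+x. ennreal_powr (ennreal \<bar>indicator (cball0 \<rho>) x\<bar>) p \<partial>\<mu>)
      = (\<integral>\<^sup>+x. indicator (cball0 \<rho>) x \<partial>\<mu>)"
    by (intro nn_integral_cong) (auto simp: indicator_def ennreal_powr_def)
  also have "\<dots> = ennreal (mass \<rho>)" by (simp add: emeasure_ball0_eq_mass)
  finally show ?thesis by (simp add: Lp_norm_def ennreal_powr_ennreal)
qed

text \<open>The weak type inequality for the indicator function of \<open>B(0,\<rho>)\<close>, solved for the
  constant.\<close>

lemma weak_type_const_ge_of_level_set:
  assumes p: "p > 0" and \<alpha>: "\<alpha> > 0" and \<rho>: "\<rho> > 0"
    and level: "\<And>x. x \<in> cball0 R \<Longrightarrow> HL_maximal d \<mu> (indicator (cball0 \<rho>)) x \<ge> ennreal \<alpha>"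
  shows "weak_type_const p d \<mu> \<ge> ennreal (\<alpha> * (mass R / mass \<rho>) powr (1 / p))"
  unfolding weak_type_const_def
proof (intro Inf_greatest)
  let ?g = "indicator (cball0 \<rho>) :: (nat \<Rightarrow> real) \<Rightarrow> real"
  fix c assume "c \<in> {c. \<forall>g \<in> Lp_space \<mu> p. \<forall>\<alpha>::real. \<alpha> > 0 \<longrightarrow>
            emeasure \<mu> {x \<in> space \<mu>. HL_maximal d \<mu> g x \<ge> ennreal \<alpha>}
              \<le> ennreal_powr (c * Lp_norm \<mu> p (\<lambda>x. ennreal \<bar>g x\<bar>) / ennreal \<alpha>) p}"
  moreover have "?g \<in> Lp_space \<mu> p"
    unfolding Lp_space_def Lp_norm_indicator_ball[OF p] mem_Collect_eq by simp
  ultimately have c: "emeasure \<mu> {x \<in> space \<mu>. HL_maximal d \<mu> ?g x \<ge> ennreal \<alpha>}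
      \<le> ennreal_powr (c * ennreal (mass \<rho> powr (1 / p)) / ennreal \<alpha>) p"
    unfolding Lp_norm_indicator_ball[OF p, symmetric] using \<alpha> by blast
  have [measurable]: "HL_maximal d \<mu> ?g \<in> borel_measurable (lborel_dim d)"
    by (intro measurable_HL_maximal) measurable
  have "cball0 R \<subseteq> {x \<in> space \<mu>. HL_maximal d \<mu> ?g x \<ge> ennreal \<alpha>}"
    using level by (auto simp: eball_def)
  then have "ennreal (mass R) \<le> emeasure \<mu> {x \<in> space \<mu>. HL_maximal d \<mu> ?g x \<ge> ennreal \<alpha>}"
    unfolding emeasure_ball0_eq_mass[symmetric] by (intro emeasure_mono) simp_all
  note this[THEN order_trans, OF c]
  then show "ennreal (\<alpha> * (mass R / mass \<rho>) powr (1 / p)) \<le> c"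
  proof (cases c)
    case (real b)
    let ?X = "b * mass \<rho> powr (1 / p) / \<alpha>"
    have X: "?X \<ge> 0" using real \<alpha> by simp
    have "c * ennreal (mass \<rho> powr (1 / p)) / ennreal \<alpha> = ennreal ?X"
      using real \<alpha> by (simp add: ennreal_mult[symmetric] divide_ennreal)
    then have "ennreal (mass R) \<le> ennreal (?X powr p)"
      using \<open>ennreal (mass R) \<le> ennreal_powr _ p\<close> X by (simp only: ennreal_powr_ennreal)
    then have "mass R \<le> ?X powr p" by simp
    then have "mass R powr (1 / p) \<le> (?X powr p) powr (1 / p)"
      using p by (intro powr_mono2) auto
    also have "\<dots> = ?X powr 1" using p by (simp add: powr_powr)
    also have "\<dots> = ?X" using X by (rule powr_one)
    finally have "\<alpha> * (mass R powr (1 / p) / mass \<rho> powr (1 / p)) \<le> b"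
      using \<alpha> mass_pos[OF \<rho>] by (simp add: field_simps)
    then show ?thesis using real by (simp add: powr_divide)
  qed simp
qed

text \<open>If \<open>x \<bullet> y \<ge> 0\<close> and \<open>|y| \<le> \<rho>\<close>, then \<open>|y - x|\<^sup>2 \<le> |x|\<^sup>2 + \<rho>\<^sup>2\<close>, so the
  averaging ball contains half of \<open>B(0,\<rho>)\<close>.\<close>

lemma HL_maximal_indicator_ge:
  assumes x: "x \<in> space (lborel_dim d)" and \<rho>: "\<rho> > 0" and M: "M > 0"
    and ball: "emeasure \<mu> (eball d x (sqrt ((norm2 d x)\<^sup>2 + \<rho>\<^sup>2))) \<le> ennreal M"
  shows "HL_maximal d \<mu> (indicator (cball0 \<rho>)) x \<ge> ennreal (mass \<rho> / 2 / M)"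
proof -
  let ?r = "sqrt ((norm2 d x)\<^sup>2 + \<rho>\<^sup>2)"
  let ?B = "eball d x ?r"
  have r: "?r > 0" using \<rho> by (simp add: add_nonneg_pos)
  have "cap_cone d x 0 \<inter> cball0 \<rho> \<subseteq> cball0 \<rho> \<inter> ?B"
  proof (intro subsetI IntI)
    fix y assume y: "y \<in> cap_cone d x 0 \<inter> cball0 \<rho>"
    then show "y \<in> cball0 \<rho>" by simp
    have "(norm2 d y)\<^sup>2 \<le> \<rho>\<^sup>2" "0 \<le> dot d x y"
      using y by (auto simp: eball_origin cap_cone_def intro: power_mono)
    then have "(norm2 d (\<lambda>i. y i - x i))\<^sup>2 \<le> (norm2 d x)\<^sup>2 + \<rho>\<^sup>2"
      unfolding norm2_diff_square by simp
    then show "y \<in> ?B" using y by (simp add: eball_def real_le_rsqrt)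
  qed
  then have "emeasure \<mu> (cap_cone d x 0 \<inter> cball0 \<rho>) \<le> emeasure \<mu> (cball0 \<rho> \<inter> ?B)"
    by (intro emeasure_mono) auto
  then have num: "ennreal (mass \<rho> / 2) \<le> emeasure \<mu> (cball0 \<rho> \<inter> ?B)"
    using half_ball_mass_ge order_trans by blast
  have "0 < ennreal (mass \<rho> / 2)" using mass_pos[OF \<rho>] by simp
  also note num
  also have "emeasure \<mu> (cball0 \<rho> \<inter> ?B) \<le> emeasure \<mu> ?B" by (intro emeasure_mono) auto
  finally have pos: "0 < emeasure \<mu> ?B" .
  have "ennreal (mass \<rho> / 2 / M) = ennreal (mass \<rho> / 2) / ennreal M"
    using M by (simp add: divide_ennreal)
  also have "\<dots> \<le> emeasure \<mu> (cball0 \<rho> \<inter> ?B) / emeasure \<mu> ?B"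
  proof (rule divide_le_posI_ennreal)
    have "emeasure \<mu> (cball0 \<rho> \<inter> ?B) = emeasure \<mu> (cball0 \<rho> \<inter> ?B) / emeasure \<mu> ?B * emeasure \<mu> ?B"
      using pos emeasure_eball_finite[of x ?r] by (simp add: ennreal_divide_times ennreal_divide_self)
    also have "\<dots> \<le> emeasure \<mu> (cball0 \<rho> \<inter> ?B) / emeasure \<mu> ?B * ennreal M"
      by (intro mult_left_mono ball) simp
    finally show "ennreal (mass \<rho> / 2) \<le> ennreal M * (emeasure \<mu> (cball0 \<rho> \<inter> ?B) / emeasure \<mu> ?B)"
      using num by (simp add: mult.commute)
  qed (use M in simp)
  also have "\<dots> = (\<integral>\<^sup>+y\<in>?B. ennreal \<bar>indicator (cball0 \<rho>) y\<bar> \<partial>\<mu>) / emeasure \<mu> ?B"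
  proof -
    have "(\<integral>\<^sup>+y\<in>?B. ennreal \<bar>indicator (cball0 \<rho>) y\<bar> \<partial>\<mu>) = (\<integral>\<^sup>+y. indicator (cball0 \<rho> \<inter> ?B) y \<partial>\<mu>)"
      by (intro nn_integral_cong) (auto simp: indicator_def)
    then show ?thesis by simp
  qed
  also have "\<dots> \<le> HL_maximal d \<mu> (indicator (cball0 \<rho>)) x"
    unfolding HL_maximal_def using r pos by (intro SUP_upper) simp
  finally show ?thesis .
qed

text \<open>With \<open>v = (64/55)\<^sup>1\<^sup>/\<^sup>6\<close>, \<open>K = 1 + 38 q\<^sup>d\<close> and \<open>a = m(\<rho>)/m(uR) \<ge> b\<^sup>d\<close>, the level set
  gives the bound \<open>a/(2K) (v\<^sup>d/(2a))\<^sup>1\<^sup>/\<^sup>p\<close>. It is nondecreasing in \<open>a\<close>, since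
  \<open>p \<ge> 1\<close>, so the worst case is
  \<open>a = b\<^sup>d\<close>; there \<open>v = 2b\<close> turns it into \<open>(2\<^sup>1\<^sup>/\<^sup>p b)\<^sup>d\<close> up to the constant factor.\<close>

lemma weak_type_const_lower_bound:
  assumes u: "u = sqrt (2 / 3)" and p: "p \<ge> 1"
    and sup: "(SUP R\<in>{0<..}. ball_ratio d \<mu> u R) \<ge> ennreal ((64 / 55) powr (real d / 6))"
    and lim: "Limsup at_top (ball_ratio d \<mu> u) \<le> ennreal ((64 / 55) powr (real d / 6))"
  shows "weak_type_const p d \<mu>
    \<ge> ennreal (1 / (4 + 15200 / sqrt (real d)) * (2 powr (1 / p) / 55 powr (1 / 6)) ^ d)"
proof -
  define v where "v = (64 / 55 :: real) powr (1 / 6)"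
  define b where "b = (55 :: real) powr (- 1 / 6)"
  have v0: "v > 0" and b0: "b > 0" and v: "v = 2 * b"
  proof -
    have "(64 :: real) powr (1 / 6) = 2"
      using powr_powr[of 2 6 "1 / 6"] by simp
    then show "v = 2 * b" by (simp add: v_def b_def powr_divide powr_minus_divide)
  qed (auto simp: v_def b_def)
  have V: "(64 / 55) powr (real d / 6) = v ^ d"
    using v0 by (simp add: v_def powr_realpow[symmetric] powr_powr)
  have u0: "u > 0" by (simp add: u)
  obtain R where R: "R > 0" and R_lower: "v ^ d / 2 * mass (u * R) \<le> mass R"
    and R_upper: "\<And>S. S \<ge> R \<Longrightarrow> mass S \<le> 2 * v ^ d * mass (u * S)"
    using radius_with_critical_growth[OF u0 _ sup lim] v0 unfolding V by auto
  define \<rho> where "\<rho> = u * R * b"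
  have \<rho>: "\<rho> > 0" using u0 R b0 by (simp add: \<rho>_def)
  have \<rho>_sq: "\<rho>\<^sup>2 \<le> 9 / 50 * R\<^sup>2"
  proof -
    \<comment> \<open>\<open>(2/3) (27/100) = 9/50\<close>.\<close>
    have "(b\<^sup>2) ^ Suc 2 = b ^ 6" by (simp flip: power_mult)
    also have "\<dots> = 1 / 55" unfolding b_def by (subst powr_power) (auto simp: powr_minus_divide)
    also have "\<dots> \<le> (27 / 100) ^ Suc 2" by (simp add: power_divide)
    finally have "b\<^sup>2 \<le> 27 / 100" by (rule power_le_imp_le_base) simp
    then have "2 / 3 * R\<^sup>2 * b\<^sup>2 \<le> 2 / 3 * R\<^sup>2 * (27 / 100)" by (intro mult_left_mono) auto
    then show ?thesis by (simp add: \<rho>_def power_mult_distrib u)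
  qed
  define K where "K = 1 + 38 * (99 / 100 :: real) ^ d"
  have K: "K > 0" by (simp add: K_def add_pos_nonneg)
  define m where "m = mass (u * R)"
  have m: "m > 0" using mass_pos[of "u * R"] u0 R by (simp add: m_def)
  define a where "a = mass \<rho> / m"
  have a_pos: "a > 0" using m mass_pos[OF \<rho>] by (simp add: a_def)
  have a_ge: "b ^ d \<le> a"
  proof -
    have b1: "b \<le> 1" using powr_mono[of "- 1 / 6" 0 55] by (simp add: b_def)
    have "m = mass (1 / b * \<rho>)" using b0 by (simp add: m_def \<rho>_def)
    also have "\<dots> \<le> (1 / b) ^ d * mass \<rho>"
      using b0 b1 by (intro mass_dilate) simp
    finally show ?thesis using m b0 by (simp add: a_def field_simps)
  qed
  have level: "HL_maximal d \<mu> (indicator (cball0 \<rho>)) x \<ge> ennreal (a / (2 * K))"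
    if "x \<in> cball0 R" for x
  proof -
    have x: "x \<in> space (lborel_dim d)" "norm2 d x \<le> R" using that by (auto simp: eball_origin)
    have "emeasure \<mu> (eball d x (sqrt ((norm2 d x)\<^sup>2 + \<rho>\<^sup>2)))
        \<le> ennreal (m * (1 + 2 * v ^ d * sqrt (54671 / 60000) ^ d
          + (2 * v ^ d)\<^sup>2 * sqrt (8319 / 10000) ^ d + (2 * v ^ d) ^ 5 * sqrt (887 / 1250) ^ d))"
      unfolding m_def using v0 by (intro averaging_ball_mass_le u R R_upper x \<rho>_sq) auto
    also have "\<dots> \<le> ennreal (m * K)"
      unfolding K_def using m by (intro ennreal_leI mult_left_mono cap_sum_le v_def) auto
    finally have "ennreal (mass \<rho> / 2 / (m * K)) \<le> HL_maximal d \<mu> (indicator (cball0 \<rho>)) x"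
      using x \<rho> m K by (intro HL_maximal_indicator_ge) auto
    then show ?thesis by (simp add: a_def mult_ac)
  qed
  let ?s = "1 / p"
  have "1 / (4 + 15200 / sqrt (real d)) * (2 powr ?s / 55 powr (1 / 6)) ^ d
      \<le> 1 / (4 * K) * (2 powr ?s * b) ^ d"
  proof -
    have "4 * K \<le> 4 + 15200 / sqrt (real d)"
      using geometric_le_inverse_sqrt[OF d] by (simp add: K_def)
    then have "1 / (4 + 15200 / sqrt (real d)) \<le> 1 / (4 * K)"
      using K by (intro divide_left_mono) (auto simp: add_pos_nonneg)
    moreover have eq: "2 powr ?s / 55 powr (1 / 6) = 2 powr ?s * b"
      by (simp add: b_def powr_minus_divide)
    ultimately show ?thesis unfolding eq using b0 by (intro mult_right_mono) simp_all
  qed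
  also have "\<dots> \<le> a / (2 * K) * (mass R / mass \<rho>) powr ?s"
  proof -
    have "v ^ d / 2 / a \<le> mass R / mass \<rho>"
      using R_lower m mass_pos[OF \<rho>] by (simp add: a_def m_def field_simps)
    then have "(v ^ d / 2 / a) powr ?s \<le> (mass R / mass \<rho>) powr ?s"
      using v0 a_pos p by (intro powr_mono2) auto
    moreover have "(2 powr ?s * b) ^ d / 2 \<le> a * (v ^ d / 2 / a) powr ?s"
    proof -
      have "(2 powr ?s * b) ^ d = (2 ^ d) powr ?s * ((b ^ d) powr (1 - ?s) * (b ^ d) powr ?s)"
      proof -
        have "(2 powr ?s) ^ d = (2 ^ d) powr ?s"
          by (simp add: powr_realpow[symmetric] powr_powr mult.commute)
        moreover have "b ^ d = (b ^ d) powr (1 - ?s) * (b ^ d) powr ?s"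
          using b0 by (subst powr_add[symmetric]) simp
        ultimately show ?thesis by (simp only: power_mult_distrib)
      qed
      also have "\<dots> \<le> (2 ^ d) powr ?s * (a powr (1 - ?s) * (b ^ d) powr ?s)"
        using a_ge b0 p by (intro mult_left_mono mult_right_mono powr_mono2) auto
      also have "\<dots> = a powr (1 - ?s) * (v ^ d) powr ?s"
        using b0 by (simp add: v power_mult_distrib powr_mult)
      finally have "(2 powr ?s * b) ^ d / 2 \<le> a powr (1 - ?s) * (v ^ d) powr ?s / 2"
        by simp
      also have "\<dots> \<le> a powr (1 - ?s) * (v ^ d) powr ?s / 2 powr ?s"
        using p powr_mono[of ?s 1 2] by (intro divide_left_mono) auto
      also have "\<dots> = a * (v ^ d / 2 / a) powr ?s"
        using a_pos v0 by (simp add: powr_divide powr_diff powr_mult)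
      finally show ?thesis .
    qed
    ultimately have "(2 powr ?s * b) ^ d / 2 \<le> a * (mass R / mass \<rho>) powr ?s"
      using a_pos by (meson mult_left_mono order_trans less_imp_le)
    then have "(2 powr ?s * b) ^ d / 2 / (2 * K) \<le> a * (mass R / mass \<rho>) powr ?s / (2 * K)"
      using K by (intro divide_right_mono) auto
    then show ?thesis by (simp add: mult_ac)
  qed
  finally have "ennreal (1 / (4 + 15200 / sqrt (real d)) * (2 powr ?s / 55 powr (1 / 6)) ^ d)
      \<le> ennreal (a / (2 * K) * (mass R / mass \<rho>) powr ?s)"
    by (rule ennreal_leI)
  also have "\<dots> \<le> weak_type_const p d \<mu>"
    using p a_pos K \<rho> level by (intro weak_type_const_ge_of_level_set) auto
  finally show ?thesis .
qed

end

lemma critical_growth_eq: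
  "sqrt (2 / 3) powr (- ((6 * ln 2 - ln 55) / (3 * ln 3 - 3 * ln 2)) * real d)
    = (64 / 55) powr (real d / 6)"
proof -
  have "ln (2 :: real) < ln 3" by simp
  moreover have "ln (64 :: real) = 6 * ln 2" using ln_realpow[of 2 6] by simp
  ultimately show ?thesis
    by (simp add: powr_def ln_sqrt ln_div field_simps)
qed

theorem theorem3p4:
  shows "\<exists>\<theta> :: nat \<Rightarrow> real.
    (\<forall>d\<ge>1. \<theta> d > 0) \<and> \<theta> \<in> \<Theta>(\<lambda>d. 1 / sqrt (real d)) \<and>
    (\<forall>(d::nat) (u::real) (f :: real \<Rightarrow> real) \<mu>.
       d \<ge> 1 \<longrightarrow> u = sqrt (2 / 3) \<longrightarrow>
       (\<forall>t>0. f t \<ge> 0) \<longrightarrow> antimono_on {0<..} f \<longrightarrow>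
       \<not> (AE t in lborel. t > 0 \<longrightarrow> f t = 0) \<longrightarrow>
       (\<forall>R>0. (\<integral>\<^sup>+t\<in>{0<..<R}. ennreal (f t * t ^ (d - 1)) \<partial>lborel) < \<infinity>) \<longrightarrow>
       \<mu> = radial_measure d f \<longrightarrow>
       u powr (- ((6 * ln 2 - ln 55) / (3 * ln 3 - 3 * ln 2)) * real d)
           = (64 / 55) powr (real d / 6) \<and>
       ((SUP R\<in>{0<..}. ball_ratio d \<mu> u R)
           \<ge> ennreal (u powr (- ((6 * ln 2 - ln 55) / (3 * ln 3 - 3 * ln 2)) * real d)) \<longrightarrow>
        ennreal ((64 / 55) powr (real d / 6)) \<ge> Limsup at_top (ball_ratio d \<mu> u) \<longrightarrow>
        (\<forall>p::real. 1 \<le> p \<longrightarrow> p < 6 * ln 2 / ln 55 \<longrightarrow>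
           55 powr (- 1 / 6) * 2 powr (1 / p) > (1::real) \<and>
           strong_type_const p d \<mu> \<ge> weak_type_const p d \<mu> \<and>
           weak_type_const p d \<mu>
             \<ge> ennreal (1 / (4 + \<theta> d) * (2 powr (1 / p) / 55 powr (1 / 6)) ^ d))))"
proof (intro exI[of _ "\<lambda>d. 15200 / sqrt (real d)"] conjI allI impI)
  show "0 < 15200 / sqrt (real d)" if "d \<ge> 1" for d using that by simp
  show "(\<lambda>d. 15200 / sqrt (real d)) \<in> \<Theta>(\<lambda>d. 1 / sqrt (real d))"
    using landau_theta.cmult_in_iff[of 15200 "\<lambda>d. 1 / sqrt (real d)" sequentially] by simp
next
  fix d :: nat and u :: real and f :: "real \<Rightarrow> real" and \<mu>
  assume u: "u = sqrt (2 / 3)"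
  show growth: "u powr (- ((6 * ln 2 - ln 55) / (3 * ln 3 - 3 * ln 2)) * real d)
      = (64 / 55) powr (real d / 6)"
    unfolding u by (rule critical_growth_eq)
  fix p :: real
  assume d: "d \<ge> 1" and f: "\<forall>t>0. f t \<ge> 0" "antimono_on {0<..} f"
    "\<not> (AE t in lborel. t > 0 \<longrightarrow> f t = 0)"
    "\<forall>R>0. (\<integral>\<^sup>+t\<in>{0<..<R}. ennreal (f t * t ^ (d - 1)) \<partial>lborel) < \<infinity>"
    and \<mu>: "\<mu> = radial_measure d f"
    and sup: "(SUP R\<in>{0<..}. ball_ratio d \<mu> u R)
      \<ge> ennreal (u powr (- ((6 * ln 2 - ln 55) / (3 * ln 3 - 3 * ln 2)) * real d))"
    and lim: "ennreal ((64 / 55) powr (real d / 6)) \<ge> Limsup at_top (ball_ratio d \<mu> u)"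
    and p: "1 \<le> p" "p < 6 * ln 2 / ln 55"
  interpret radial_decreasing d f
    using d f by unfold_locales auto
  show "weak_type_const p d \<mu>
      \<ge> ennreal (1 / (4 + 15200 / sqrt (real d)) * (2 powr (1 / p) / 55 powr (1 / 6)) ^ d)"
    using weak_type_const_lower_bound[OF u p(1)] sup lim unfolding growth \<mu> .
  show "weak_type_const p d \<mu> \<le> strong_type_const p d \<mu>"
    by (rule weak_type_const_le_strong_type_const[OF p(1)])
  have "ln (55 :: real) > 0" by simp
  then have "ln 55 / 6 < ln 2 / p" using p by (simp add: field_simps)
  then show "(1 :: real) < 55 powr (- 1 / 6) * 2 powr (1 / p)"
    by (simp add: powr_def exp_add[symmetric])
qed

end
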